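(* Let $s\in\mathbb{C}$ with $\mathrm{Re}\,s\in(0,1)$, let $\zeta$ be the Riemann zeta function, and for $y\in\mathbb{R}$ let $$f_{1,s,1}(y)=\pi2^{s-2}\left(\frac{|y|^s\cos y}{\sin(\pi s/2)}-\frac{|y|^s\,\mathrm{sgn}(y)\sin y}{\cos(\pi s/2)}\right),\qquad g_{1,s,1}(y)=\frac{\pi2^{s-1}y^2\cos y}{\cos(\pi s/2)}\sum_{n=0}^\infty\frac{[\pi(n+1/2)]^{s-1}}{y^2-[\pi(n+1/2)]^2}.$$ Then: (a) If $\zeta(s)=0$, then $f_{1,s,1}-g_{1,s,1}\in L_p(\mathbb{R})$ for every $p\in(1/2,\infty)$. (b) If there exists $p\in(1/2,\infty)$ such that $f_{1,s,1}-g_{1,s,1}\in L_p(\mathbb{R})$, then $\zeta(s)=0$.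
   Context: For $0<p<\infty$, $L_p(\mathbb{R})$ is the space of measurable $F:\mathbb{R}\to\mathbb{C}$ with $\int_{\mathbb{R}}|F(y)|^p\,dy<\infty$ (also for $p<1$). Complex powers of positive reals are principal, and $0^s=0$. At $y=\pm\pi(n+1/2)$ the product $\cos y/(y^2-[\pi(n+1/2)]^2)$ is understood by continuity. *)

theory Defs
  imports "HOL-Complex_Analysis.Complex_Analysis"
begin

(* The Dirichlet series on Re z > 1, continued analytically to a punctured half-plane
   {z. Re z > c} - {1} that contains s; "riemann_zeta_eqI" shows that the value at s depends
   neither on c nor on the continuation. The value at the pole s = 1 is unspecified. *)
definition zeta_continuation :: "real \<Rightarrow> (complex \<Rightarrow> complex) \<Rightarrow> bool" where
  "zeta_continuation c h \<longleftrightarrow>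
     h holomorphic_on ({z. Re z > c} - {1}) \<and>
     (\<forall>z. Re z > 1 \<longrightarrow> (\<lambda>n. 1 / of_nat (Suc n) powr z) sums h z)"

definition riemann_zeta :: "complex \<Rightarrow> complex" where
  "riemann_zeta s = (THE w. \<exists>c h. c < Re s \<and> zeta_continuation c h \<and> w = h s)"

lemma zeta_continuation_unique:
  assumes h: "zeta_continuation c h" and k: "zeta_continuation d k"
    and "c < Re s" "d < Re s" "s \<noteq> 1"
  shows "h s = k s"
proof -
  define e where "e = max c d"
  define H where "H = {z. Re z > e} - {1::complex}"
  define T where "T = {z. Re z > max e 1}"
  have "open H" unfolding H_def by (intro open_Diff open_halfspace_Re_gt) auto
  have "connected H" unfolding H_def
    by (intro connected_open_delete open_halfspace_Re_gt convex_connected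
        convex_halfspace_Re_gt) auto
  have hol: "h holomorphic_on H" "k holomorphic_on H"
    using h k unfolding zeta_continuation_def H_def e_def
    by (auto elim!: holomorphic_on_subset)
  have "open T" unfolding T_def by (rule open_halfspace_Re_gt)
  have "of_real (max e 1 + 1) \<in> T" unfolding T_def by (auto simp: max_def)
  hence "T \<noteq> {}" by blast
  have "T \<subseteq> H" by (auto simp: T_def H_def)
  have eq: "h z = k z" if "z \<in> T" for z
    using h k that unfolding zeta_continuation_def T_def by (auto intro: sums_unique2)
  have "s \<in> H" using assms by (auto simp: H_def e_def)
  show ?thesis
    by (rule analytic_continuation_open[OF \<open>open T\<close> \<open>open H\<close> \<open>T \<noteq> {}\<close> \<open>connected H\<close>
          \<open>T \<subseteq> H\<close> hol eq \<open>s \<in> H\<close>])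
qed

lemma riemann_zeta_eqI:
  assumes "zeta_continuation c h" "c < Re s" "s \<noteq> 1"
  shows "riemann_zeta s = h s"
  unfolding riemann_zeta_def
proof (rule the_equality)
  show "\<exists>c k. c < Re s \<and> zeta_continuation c k \<and> h s = k s" using assms by blast
next
  fix w assume "\<exists>c k. c < Re s \<and> zeta_continuation c k \<and> w = k s"
  thus "w = h s" using assms zeta_continuation_unique by metis
qed

definition Lp :: "real \<Rightarrow> (real \<Rightarrow> complex) set" where
  "Lp p = {F. F \<in> borel_measurable lebesgue \<and>
              (\<integral>\<^sup>+ y. ennreal (norm (F y) powr p) \<partial>lebesgue) < \<infinity>}"

definition node :: "nat \<Rightarrow> real" where
  "node n = pi * (real n + 1 / 2)"

definition cos_quot :: "nat \<Rightarrow> real \<Rightarrow> real" where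
  "cos_quot n y =
     (if y\<^sup>2 \<noteq> (node n)\<^sup>2 then cos y / (y\<^sup>2 - (node n)\<^sup>2)
      else Lim (at y) (\<lambda>t. cos t / (t\<^sup>2 - (node n)\<^sup>2)))"

definition f1 :: "complex \<Rightarrow> real \<Rightarrow> complex" where
  "f1 s y = of_real pi * 2 powr (s - 2) *
     (of_real \<bar>y\<bar> powr s * of_real (cos y) / sin (of_real pi * s / 2)
      - of_real \<bar>y\<bar> powr s * of_real (sgn y) * of_real (sin y) / cos (of_real pi * s / 2))"

(* The factor cos y is moved inside the sum, so that its product with each 1 / (y^2 - (node n)^2)
   can be extended by continuity to y = node n and y = - node n. *)
definition g1 :: "complex \<Rightarrow> real \<Rightarrow> complex" where
  "g1 s y = of_real pi * 2 powr (s - 1) * (of_real y)\<^sup>2 / cos (of_real pi * s / 2) *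
     (\<Sum>n. of_real (node n) powr (s - 1) * of_real (cos_quot n y))"

end

theory Submission
  imports Defs
begin

text \<open>
  Writing the powers of the nodes $a = \pi(n + 1/2)$ as Mellin transforms of $1/(x^2 + a^2)$ and using
  the partial fraction expansions of $\tan$ and $\tanh$ over these nodes, the series defining $g_{1,s,1}(y)$ becomes the
  Mellin type integral of $x^{s-1} \tanh x/(x^2 + y^2)$ over $x > 0$ plus a term in $\tan y$ that
  cancels the sine part of $f_{1,s,1}(y)$. The cosine part of $f_{1,s,1}(y)$ is the same integral with
  $1$ in place of $\tanh x$, so that
  $$f_{1,s,1}(y) - g_{1,s,1}(y)
    = 2^{s-1} \cos y \int_0^\infty x^{s-1} (1 - \tanh x) \frac{y^2}{x^2 + y^2}\,dx.$$
  As $1 - \tanh x = 2/(e^{2x} + 1)$, this is $\cos y\,(\Gamma(s)\eta(s) + O(y^{-2}))$ and bounded,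
  where $\eta(s) = (1 - 2^{1-s})\zeta(s)$; no functional equation is needed.
\<close>

section \<open>The alternating zeta function in the right half-plane\<close>

text \<open>The bound 1/2 on p is where |y|^(-2 p) stops being integrable at infinity: once the
  leading coefficient vanishes, a remainder of order y^-2 is p-integrable for p > 1/2. A nonzero
  coefficient leaves a multiple of |cos y|, which is p-integrable for no p > 0, so a single p
  suffices in (b). In the strip the coefficient vanishes only through zeta, because Gamma has no
  zeros and those of 1 - 2^(1-s) lie on Re s = 1.

  Two obstacles shape the proof. The strip lies outside the absolute convergence of the alternating
  series, so its terms, and the exponentials whose Mellin transforms they are, enter in consecutive
  pairs; the pairs of exponentials are nonnegative and can be summed in norm. And
  \<open>riemann_zeta\<close> is specified by uniqueness of continuations, so a continuation that
  reaches the strip has to be built. The closed form is derived off 0 and the zeros of cos y;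
  equality almost everywhere then carries over both measurability and the integrals.\<close>

lemma norm_powr_diff_le:
  fixes z :: complex and a b :: real
  assumes "0 < a" "a \<le> b" "Re z \<ge> 0"
  shows "norm (of_real a powr - z - of_real b powr - z) \<le> norm z * a powr (- Re z - 1) * (b - a)"
proof -
  let ?f = "\<lambda>t. complex_of_real t powr - z"
  \<comment> \<open>Mean value inequality on [a, b]: the derivative -z t^(-z-1) has norm |z| t^(-Re
    z - 1), which decreases in t and so is largest at a.\<close>
  have "norm (?f b - ?f a) \<le> (norm z * a powr (- Re z - 1)) * norm (b - a)"
  proof (rule differentiable_bound[where S = "{a..b}"])
    show "(?f has_derivative (\<lambda>h. of_real h * (- z * of_real x powr (- z - 1)))) (at x within {a..b})"
      if "x \<in> {a..b}" for x
    proof -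
      have "(?f has_vector_derivative - z * of_real x powr (- z - 1)) (at x within {a..b})"
        using assms that
        by (intro has_vector_derivative_real_field) (auto intro!: derivative_eq_intros)
      thus ?thesis by (simp add: has_vector_derivative_def scaleR_conv_of_real)
    qed
    show "onorm (\<lambda>h. of_real h * (- z * of_real x powr (- z - 1))) \<le> norm z * a powr (- Re z - 1)"
      if "x \<in> {a..b}" for x
    proof (rule onorm_bound)
      fix h :: real
      have "x powr (- Re z - 1) \<le> a powr (- Re z - 1)"
        using that assms by (intro powr_mono2') auto
      hence "\<bar>h\<bar> * (norm z * x powr (- Re z - 1)) \<le> \<bar>h\<bar> * (norm z * a powr (- Re z - 1))"
        by (intro mult_left_mono) auto
      moreover have "norm (of_real x powr (- z - 1)) = x powr (- Re z - 1)"
        using that assms by (subst norm_powr_real_powr) auto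
      ultimately show "norm (of_real h * (- z * of_real x powr (- z - 1))) \<le> norm z * a powr (- Re z - 1) * norm h"
        by (simp add: norm_mult mult_ac)
    qed auto
  qed (use assms in auto)
  thus ?thesis using assms by (simp add: norm_minus_commute)
qed

text \<open>The alternating series is summed in pairs, which makes it converge absolutely for $\Re z > 0$.\<close>

definition dirichlet_eta :: "complex \<Rightarrow> complex" where
  "dirichlet_eta z = (\<Sum>n. of_real (2 * real n + 1) powr - z - of_real (2 * real n + 2) powr - z)"

text \<open>The quotient is $\int_{n+1}^{n+2} t^{-z}\,dt$, and these integrals add up to $1/(z-1)$ when $\Re z > 1$.\<close>

definition zeta_term :: "complex \<Rightarrow> nat \<Rightarrow> complex" where
  "zeta_term z n = of_real (real n + 1) powr - z
     - (of_real (real n + 1) powr (1 - z) - of_real (real n + 2) powr (1 - z)) / (z - 1)"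

text \<open>Interpolating in the length t of the interval of integration gives a function that
  vanishes at t = 0, equals the term at t = 1 and has derivative a^(-z) - (a+t)^(-z), where a = n +
  1. The previous estimate bounds this derivative.\<close>

lemma norm_zeta_term_le:
  assumes "Re z > 0" "z \<noteq> 1"
  shows "norm (zeta_term z n) \<le> norm z * (real n + 1) powr (- Re z - 1)"
proof -
  define a where "a = real n + 1"
  define f where "f t = t *\<^sub>R (complex_of_real a powr - z)
     - (of_real a powr (1 - z) - of_real (a + t) powr (1 - z)) / (z - 1)" for t :: real
  have a: "a > 0" by (simp add: a_def)
  have "norm (f 1 - f 0) \<le> norm z * a powr (- Re z - 1) * norm (1 - 0 :: real)"
  proof (rule differentiable_bound[where S = "{0..1}"])
    fix t :: real assume t: "t \<in> {0..1}"
    let ?d = "of_real a powr - z - of_real (a + t) powr - z"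
    have "((\<lambda>t. of_real t * (complex_of_real a powr - z)
        - (of_real a powr (1 - z) - of_real (a + t) powr (1 - z)) / (z - 1)) has_vector_derivative ?d)
        (at t within {0..1})"
    proof -
      have "((\<lambda>w. w * (complex_of_real a powr - z)
         - (of_real a powr (1 - z) - (of_real a + w) powr (1 - z)) / (z - 1)) has_field_derivative ?d)
         (at (of_real t))"
      proof -
        have "((\<lambda>w. (of_real a + w) powr (1 - z)) has_field_derivative
            (1 - z) * of_real (a + t) powr - z) (at (of_real t))"
          using a t by (auto intro!: derivative_eq_intros simp: complex_nonpos_Reals_iff)
        note [derivative_intros] = DERIV_cong[OF this]
        show ?thesis
          using assms by (auto intro!: derivative_eq_intros simp: divide_simps) (simp_all add: algebra_simps)?
      qed
      from has_vector_derivative_real_field[OF this, of "{0..1}"] show ?thesis by simp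
    qed
    thus "(f has_derivative (\<lambda>h. of_real h * ?d)) (at t within {0..1})"
      by (simp add: f_def [abs_def] has_vector_derivative_def scaleR_conv_of_real)
    show "onorm (\<lambda>h. of_real h * ?d) \<le> norm z * a powr (- Re z - 1)"
    proof (rule onorm_bound)
      fix h :: real
      have "norm ?d \<le> norm z * a powr (- Re z - 1) * (a + t - a)"
        using a t assms by (intro norm_powr_diff_le) auto
      also have "\<dots> \<le> norm z * a powr (- Re z - 1) * 1"
        using t by (intro mult_left_mono) auto
      finally have "\<bar>h\<bar> * norm ?d \<le> \<bar>h\<bar> * (norm z * a powr (- Re z - 1))"
        by (intro mult_left_mono) auto
      thus "norm (of_real h * ?d) \<le> norm z * a powr (- Re z - 1) * norm h"
        by (simp add: norm_mult mult_ac)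
    qed auto
  qed auto
  moreover have "f 1 - f 0 = zeta_term z n"
    by (simp add: f_def zeta_term_def a_def add_ac)
  ultimately show ?thesis by (simp add: a_def)
qed

section \<open>Locally uniform convergence and holomorphy\<close>

lemma summable_shifted_powr:
  assumes "e > 1" shows "summable (\<lambda>n. (real n + 1) powr - e)"
proof -
  have "summable (\<lambda>n. real n powr - e)"
    using assms by (subst summable_real_powr_iff) auto
  hence "summable (\<lambda>n. real (Suc n) powr - e)"
    by (subst summable_Suc_iff)
  thus ?thesis by (simp add: add_ac)
qed

text \<open>Both series obey the same termwise bound, so one Weierstrass argument serves
  \<open>dirichlet_eta\<close> and the sum of \<open>zeta_term\<close>.\<close>

lemma holomorphic_suminf_powr_bound:
  fixes f :: "complex \<Rightarrow> nat \<Rightarrow> complex"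
  assumes S: "open S" "S \<subseteq> {z. Re z > 0}"
    and hol: "\<And>n. (\<lambda>z. f z n) holomorphic_on S"
    and bound: "\<And>z n. z \<in> S \<Longrightarrow> norm (f z n) \<le> norm z * (real n + 1) powr (- Re z - 1)"
  shows "(\<lambda>z. \<Sum>n. f z n) holomorphic_on S"
proof (rule holomorphic_uniform_sequence[OF S(1)])
  show "(\<lambda>z. \<Sum>n<N. f z n) holomorphic_on S" for N
    by (intro holomorphic_on_sum hol)
  fix z assume z: "z \<in> S"
  obtain r where r: "r > 0" "cball z r \<subseteq> S"
    using S(1) z open_contains_cball by blast
  \<comment> \<open>On the ball of this radius Re x stays at least Re z / 2, which keeps the
    exponent uniformly below -1.\<close>
  define d where "d = min r (Re z / 2)"
  have "Re z > 0" using S z by auto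
  hence d: "d > 0" using r by (simp add: d_def)
  have sub: "cball z d \<subseteq> S" using r by (auto simp: d_def)
  have "uniform_limit (cball z d) (\<lambda>N z. \<Sum>n<N. f z n) (\<lambda>z. \<Sum>n. f z n) sequentially"
  proof (rule Weierstrass_m_test)
    fix n x assume x: "x \<in> cball z d"
    have norm: "norm x \<le> norm z + d"
      using norm_triangle_ineq[of z "x - z"] x by (simp add: dist_norm norm_minus_commute)
    have "\<bar>Re (z - x)\<bar> \<le> d"
      using abs_Re_le_cmod[of "z - x"] x unfolding mem_cball dist_norm by linarith
    moreover have "d \<le> Re z / 2" by (simp add: d_def)
    ultimately have "Re x \<ge> Re z / 2" by simp
    hence "(real n + 1) powr (- Re x - 1) \<le> (real n + 1) powr - (Re z / 2 + 1)"
      by (intro powr_mono) auto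
    with norm have "norm x * (real n + 1) powr (- Re x - 1)
        \<le> (norm z + d) * (real n + 1) powr - (Re z / 2 + 1)"
      using d by (intro mult_mono) auto
    thus "norm (f x n) \<le> (norm z + d) * (real n + 1) powr - (Re z / 2 + 1)"
      using bound[of x n] sub x by force
  next
    show "summable (\<lambda>n. (norm z + d) * (real n + 1) powr - (Re z / 2 + 1))"
      using \<open>Re z > 0\<close> by (intro summable_mult summable_shifted_powr) auto
  qed
  thus "\<exists>d>0. cball z d \<subseteq> S \<and> uniform_limit (cball z d) (\<lambda>N z. \<Sum>n<N. f z n) (\<lambda>z. \<Sum>n. f z n) sequentially"
    using d sub by blast
qed

lemma norm_dirichlet_eta_term_le:
  assumes "Re z > 0"
  shows "norm (of_real (2 * real n + 1) powr - z - of_real (2 * real n + 2) powr - z)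
    \<le> norm z * (real n + 1) powr (- Re z - 1)"
proof -
  have "norm (of_real (2 * real n + 1) powr - z - of_real (2 * real n + 2) powr - z)
      \<le> norm z * (2 * real n + 1) powr (- Re z - 1) * (2 * real n + 2 - (2 * real n + 1))"
    using assms by (intro norm_powr_diff_le) auto
  also have "\<dots> = norm z * (2 * real n + 1) powr (- Re z - 1)" by simp
  \<comment> \<open>Lowering the base to n + 1 brings the bound to the form shared with
    \<open>zeta_term\<close>.\<close>
  also have "\<dots> \<le> norm z * (real n + 1) powr (- Re z - 1)"
    using assms by (intro mult_left_mono powr_mono2') auto
  finally show ?thesis .
qed

lemma summable_dirichlet_eta:
  assumes "Re z > 0"
  shows "summable (\<lambda>n. of_real (2 * real n + 1) powr - z - of_real (2 * real n + 2) powr - z)"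
proof (rule summable_comparison_test')
  show "summable (\<lambda>n. norm z * (real n + 1) powr - (Re z + 1))"
    using assms by (intro summable_mult summable_shifted_powr) auto
qed (use norm_dirichlet_eta_term_le[OF assms] in simp)

lemma dirichlet_eta_holomorphic: "dirichlet_eta holomorphic_on {z. Re z > 0}"
  unfolding dirichlet_eta_def [abs_def]
proof (rule holomorphic_suminf_powr_bound)
  show "(\<lambda>z. of_real (2 * real n + 1) powr - z - of_real (2 * real n + 2) powr - z)
      holomorphic_on {z. 0 < Re z}" for n
    by (auto intro!: holomorphic_intros simp: complex_nonpos_Reals_iff)
qed (use norm_dirichlet_eta_term_le open_halfspace_Re_gt in blast)+

text \<open>The sum of n^(-z) is compared with the integral of t^(-z). Dividing
  \<open>dirichlet_eta\<close> by 1 - 2^(1-z) would be a shorter formula, but that factor has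
  further zeros on Re z = 1, where holomorphy would need a separate argument.\<close>

definition zeta_half_plane :: "complex \<Rightarrow> complex" where
  "zeta_half_plane z = 1 / (z - 1) + (\<Sum>n. zeta_term z n)"

lemma zeta_half_plane_holomorphic: "zeta_half_plane holomorphic_on ({z. Re z > 0} - {1})"
proof -
  have "(\<lambda>z. \<Sum>n. zeta_term z n) holomorphic_on ({z. Re z > 0} - {1})"
  proof (rule holomorphic_suminf_powr_bound)
    show "(\<lambda>z. zeta_term z n) holomorphic_on {z. 0 < Re z} - {1}" for n
      by (auto intro!: holomorphic_intros simp: zeta_term_def complex_nonpos_Reals_iff)
    show "open ({z. 0 < Re z} - {1::complex})"
      by (intro open_Diff open_halfspace_Re_gt) auto
  qed (auto intro: norm_zeta_term_le)
  thus ?thesis unfolding zeta_half_plane_def [abs_def]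
    by (intro holomorphic_intros) auto
qed

section \<open>Agreement with the Dirichlet series and with eta\<close>

lemma tendsto_powr_real_zero:
  fixes z :: complex assumes "Re z < 0"
  shows "(\<lambda>n. complex_of_real (real n + 1) powr z) \<longlonglongrightarrow> 0"
proof (rule tendsto_norm_zero_cancel)
  have "(\<lambda>n. (real n + 1) powr Re z) \<longlonglongrightarrow> 0"
  proof (rule tendsto_neg_powr[OF assms])
    show "filterlim (\<lambda>n. real n + 1) at_top sequentially"
      using filterlim_real_sequentially by (rule filterlim_at_top_mono) auto
  qed
  moreover have "norm (complex_of_real (real n + 1) powr z) = (real n + 1) powr Re z" for n
    by (subst norm_powr_real_powr) auto
  ultimately show "(\<lambda>n. norm (complex_of_real (real n + 1) powr z)) \<longlonglongrightarrow> 0" by simp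
qed

lemma zeta_half_plane_sums:
  assumes "Re z > 1"
  shows "(\<lambda>n. of_real (real n + 1) powr - z) sums zeta_half_plane z"
proof -
  have "z \<noteq> 1" using assms by auto
  have "summable (zeta_term z)"
  proof (rule summable_comparison_test')
    show "summable (\<lambda>n. norm z * (real n + 1) powr - (Re z + 1))"
      using assms by (intro summable_mult summable_shifted_powr) auto
  qed (use norm_zeta_term_le[of z] assms \<open>z \<noteq> 1\<close> in auto)
  hence 1: "zeta_term z sums (\<Sum>n. zeta_term z n)" by (rule summable_sums)
  have "(\<lambda>n. of_real (real n + 1) powr (1 - z) - of_real (real (Suc n) + 1) powr (1 - z)) sums
      (of_real (real 0 + 1) powr (1 - z) - 0)"
    using assms by (intro telescope_sums' tendsto_powr_real_zero) auto
  hence "(\<lambda>n. (of_real (real n + 1) powr (1 - z) - of_real (real (Suc n) + 1) powr (1 - z)) / (z - 1))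
      sums (1 / (z - 1))"
    using sums_divide by fastforce
  from sums_add[OF this 1] show ?thesis
    by (simp add: zeta_term_def zeta_half_plane_def add_ac)
qed

lemma zeta_continuation_zeta_half_plane: "zeta_continuation 0 zeta_half_plane"
  unfolding zeta_continuation_def
proof (intro conjI allI impI zeta_half_plane_holomorphic)
  fix z :: complex assume "Re z > 1"
  from zeta_half_plane_sums[OF this] show "(\<lambda>n. 1 / of_nat (Suc n) powr z) sums zeta_half_plane z"
    by (simp add: powr_minus_divide add_ac)
qed

text \<open>The pairs with a minus sign are the pairs with a plus sign less twice the terms with
  even base, and those terms add up to 2^(-z) times the whole series.\<close>

lemma dirichlet_eta_eq_zeta_half_plane:
  assumes "Re z > 1"
  shows "dirichlet_eta z = (1 - 2 powr (1 - z)) * zeta_half_plane z"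
proof -
  let ?a = "\<lambda>n::nat. complex_of_real (real n + 1) powr - z"
  have "(\<lambda>n. \<Sum>i = n * 2..<n * 2 + 2. ?a i) sums zeta_half_plane z"
    by (rule sums_group[OF zeta_half_plane_sums[OF assms]]) auto
  moreover have "(\<Sum>i = n * 2..<n * 2 + 2. ?a i) =
     of_real (2 * real n + 1) powr - z + of_real (2 * real n + 2) powr - z" for n
  proof -
    have "{n * 2..<n * 2 + 2} = {n * 2, n * 2 + 1}" by auto
    thus ?thesis by (simp add: mult.commute add_ac)
  qed
  ultimately have 1: "(\<lambda>n. of_real (2 * real n + 1) powr - z + of_real (2 * real n + 2) powr - z)
     sums zeta_half_plane z" by simp
  have "of_real (2 * real n + 2) powr - z = 2 powr - z * ?a n" for n
  proof -
    have "complex_of_real (2 * real n + 2) = of_real 2 * of_real (real n + 1)" by simp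
    also have "\<dots> powr - z = of_real 2 powr - z * ?a n" by (rule powr_times_real) auto
    finally show ?thesis by simp
  qed
  hence 2: "(\<lambda>n. of_real (2 * real n + 2) powr - z) sums (2 powr - z * zeta_half_plane z)"
    using sums_mult[OF zeta_half_plane_sums[OF assms]] by simp
  have "(\<lambda>n. of_real (2 * real n + 1) powr - z - of_real (2 * real n + 2) powr - z)
     sums (zeta_half_plane z - 2 * (2 powr - z * zeta_half_plane z))"
    using sums_diff[OF 1 sums_mult[OF 2, of 2]] by (simp add: algebra_simps)
  moreover have "2 * (2 powr - z) = (2 powr (1 - z) :: complex)"
    by (simp add: powr_diff powr_minus field_simps)
  ultimately show ?thesis unfolding dirichlet_eta_def by (simp add: sums_iff algebra_simps flip: mult.assoc)
qed

text \<open>Identity theorem: the half-plane without the pole at 1 is connected and contains Re z >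
  1, where the relation was read off from the series.\<close>

lemma dirichlet_eta_eq_riemann_zeta:
  assumes "Re s > 0" "s \<noteq> 1"
  shows "dirichlet_eta s = (1 - 2 powr (1 - s)) * riemann_zeta s"
proof -
  define H where "H = {z. Re z > 0} - {1::complex}"
  have 1: "open H" unfolding H_def by (intro open_Diff open_halfspace_Re_gt) auto
  have 2: "connected H" unfolding H_def
    by (intro connected_open_delete open_halfspace_Re_gt convex_connected convex_halfspace_Re_gt) auto
  have 3: "dirichlet_eta holomorphic_on H"
    using dirichlet_eta_holomorphic by (rule holomorphic_on_subset) (auto simp: H_def)
  have 4: "(\<lambda>s. (1 - 2 powr (1 - s)) * zeta_half_plane s) holomorphic_on H"
    using zeta_half_plane_holomorphic unfolding H_def by (auto intro!: holomorphic_intros)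
  have "(2::complex) \<in> {z. 1 < Re z}" by simp
  hence 5: "{z. 1 < Re z} \<noteq> {}" by blast
  have 6: "{z. 1 < Re z} \<subseteq> H" by (auto simp: H_def)
  have 7: "s \<in> H" using assms by (auto simp: H_def)
  have 8: "dirichlet_eta z = (1 - 2 powr (1 - z)) * zeta_half_plane z" if "z \<in> {z. 1 < Re z}" for z
    using that dirichlet_eta_eq_zeta_half_plane by simp
  have "dirichlet_eta s = (1 - 2 powr (1 - s)) * zeta_half_plane s"
    by (rule analytic_continuation_open[OF open_halfspace_Re_gt 1 5 2 6 3 4 8 7])
  thus ?thesis
    using riemann_zeta_eqI[OF zeta_continuation_zeta_half_plane] assms by simp
qed

section \<open>Mellin integrals on the positive half-line\<close>

text \<open>With the open half-line as the whole space, powers that are singular at 0 are measurable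
  by continuity, and Fubini's theorem applies to the product of the measure with itself.\<close>

definition pos_lborel :: "real measure" where
  "pos_lborel = restrict_space lborel {0<..}"

lemma space_pos_lborel [simp]: "space pos_lborel = {0<..}"
  by (simp add: pos_lborel_def space_restrict_space)

lemma sets_pos_lborel [measurable_cong]: "sets pos_lborel = sets (restrict_space borel {0<..})"
  unfolding pos_lborel_def by (intro sets_restrict_space_cong) simp

lemma sigma_finite_pos_lborel: "sigma_finite_measure pos_lborel"
  unfolding pos_lborel_def by (rule sigma_finite_measure_restrict_space) (auto intro: lborel.sigma_finite_measure_axioms)

interpretation pos_lborel: sigma_finite_measure pos_lborel
  by (rule sigma_finite_pos_lborel)

interpretation pos_lborel_pair: pair_sigma_finite pos_lborel pos_lborel ..

lemma borel_measurable_pos_lborel_continuous: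
  "continuous_on {0<..} f \<Longrightarrow> f \<in> borel_measurable pos_lborel"
  using borel_measurable_continuous_on_restrict[of "{0<..}" f]
  by (simp cong: measurable_cong_sets add: sets_pos_lborel)

lemma measurable_pos_lborel_ident [measurable]: "(\<lambda>x. x) \<in> pos_lborel \<rightarrow>\<^sub>M borel"
  by (intro borel_measurable_pos_lborel_continuous continuous_intros)

lemma measurable_pos_lborel_powr [measurable]:
  "(\<lambda>x. complex_of_real x powr z) \<in> borel_measurable pos_lborel"
  by (intro borel_measurable_pos_lborel_continuous continuous_intros) auto

text \<open>A bridge between the Bochner integral, used for Fubini and for termwise integration, and
  absolute integrability on \<open>{0<..}\<close>, in terms of which the Gamma integral and the
  change of variables are stated.\<close>

lemma has_bochner_integral_pos_lborel_iff:
  fixes f :: "real \<Rightarrow> 'a :: euclidean_space"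
  assumes [measurable]: "f \<in> borel_measurable pos_lborel"
  shows "has_bochner_integral pos_lborel f I \<longleftrightarrow>
         f absolutely_integrable_on {0<..} \<and> integral {0<..} f = I"
proof -
  have m: "(\<lambda>x. indicator {0<..} x *\<^sub>R f x) \<in> borel_measurable lborel"
    using assms borel_measurable_restrict_space_iff[of "{0<..}" lborel f]
    by (simp add: pos_lborel_def)
  have "has_bochner_integral pos_lborel f I \<longleftrightarrow>
        has_bochner_integral lborel (\<lambda>x. indicator {0<..} x *\<^sub>R f x) I"
    unfolding pos_lborel_def by (subst has_bochner_integral_restrict_space) auto
  also have "\<dots> \<longleftrightarrow> integrable lebesgue (\<lambda>x. indicator {0<..} x *\<^sub>R f x) \<and>
       integral\<^sup>L lebesgue (\<lambda>x. indicator {0<..} x *\<^sub>R f x) = I"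
    using m by (simp add: has_bochner_integral_iff integrable_completion integral_completion)
  also have "\<dots> \<longleftrightarrow> f absolutely_integrable_on {0<..} \<and> integral {0<..} f = I"
    using set_lebesgue_integral_eq_integral(2)[of "{0<..}" f]
    by (auto simp: set_integrable_def set_lebesgue_integral_def)
  finally show ?thesis .
qed

lemma has_bochner_integral_pos_lborel_substitution:
  fixes f :: "real \<Rightarrow> 'a :: euclidean_space"
  assumes [measurable]: "f \<in> borel_measurable pos_lborel"
      "(\<lambda>x. g' x *\<^sub>R f (g x)) \<in> borel_measurable pos_lborel"
    and g: "\<And>x. x > 0 \<Longrightarrow> (g has_real_derivative g' x) (at x)" "\<And>x. x > 0 \<Longrightarrow> g' x > 0"
    and bij: "bij_betw g {0<..} {0<..}"
    and int: "has_bochner_integral pos_lborel f I"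
  shows "has_bochner_integral pos_lborel (\<lambda>x. g' x *\<^sub>R f (g x)) I"
proof -
  have "(\<lambda>x. \<bar>g' x\<bar> *\<^sub>R f (g x)) absolutely_integrable_on {0<..} \<and>
        integral {0<..} (\<lambda>x. \<bar>g' x\<bar> *\<^sub>R f (g x)) = I"
    using int bij g
    by (subst has_absolute_integral_change_of_variables_real)
       (auto simp: has_bochner_integral_pos_lborel_iff bij_betw_def intro: has_field_derivative_at_within)
  moreover have "(\<lambda>x. \<bar>g' x\<bar> *\<^sub>R f (g x)) absolutely_integrable_on {0<..} \<longleftrightarrow>
     (\<lambda>x. g' x *\<^sub>R f (g x)) absolutely_integrable_on {0<..}"
  proof (rule set_integrable_cong)
    show "\<bar>g' x\<bar> *\<^sub>R f (g x) = g' x *\<^sub>R f (g x)" if "x \<in> {0<..}" for x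
      using g(2)[of x] that by simp
  qed auto
  moreover have "integral {0<..} (\<lambda>x. \<bar>g' x\<bar> *\<^sub>R f (g x)) = integral {0<..} (\<lambda>x. g' x *\<^sub>R f (g x))"
  proof (rule integral_cong)
    show "\<bar>g' x\<bar> *\<^sub>R f (g x) = g' x *\<^sub>R f (g x)" if "x \<in> {0<..}" for x
      using g(2)[of x] that by simp
  qed
  ultimately show ?thesis by (subst has_bochner_integral_pos_lborel_iff) auto
qed

section \<open>The Gamma integral and two rational Mellin integrals\<close>

lemma has_bochner_integral_Gamma:
  assumes "Re z > 0" "a > 0"
  shows "has_bochner_integral pos_lborel (\<lambda>x. of_real x powr (z - 1) * of_real (exp (- (a * x))))
           (Gamma z / of_real a powr z)"
proof -
  let ?f = "\<lambda>x. complex_of_real x powr (z - 1) * of_real (exp (- x))"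
  have "has_bochner_integral pos_lborel ?f (Gamma z)"
    using absolutely_integrable_Gamma_integral'[OF assms(1)] Gamma_integral_complex'[OF assms(1)]
    by (subst has_bochner_integral_pos_lborel_iff)
       (auto simp: exp_minus field_simps integral_unique)
  hence "has_bochner_integral pos_lborel (\<lambda>x. a *\<^sub>R ?f (a * x)) (Gamma z)"
  proof (rule has_bochner_integral_pos_lborel_substitution[rotated -1])
    show "bij_betw ((*) a) {0<..} {0<..}"
      by (rule bij_betwI[where g = "\<lambda>x. x / a"]) (use assms in auto)
    have "(\<lambda>x. complex_of_real (a * x) powr (z - 1)) \<in> borel_measurable pos_lborel"
      using assms by (intro borel_measurable_pos_lborel_continuous continuous_intros) auto
    thus "(\<lambda>x. a *\<^sub>R ?f (a * x)) \<in> borel_measurable pos_lborel" by measurable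
  qed (use assms in \<open>auto intro!: derivative_eq_intros\<close>)
  hence "has_bochner_integral pos_lborel (\<lambda>x. (a *\<^sub>R ?f (a * x)) / of_real a powr z)
      (Gamma z / of_real a powr z)"
    by (rule has_bochner_integral_divide_zero)
  also have "?this \<longleftrightarrow> ?thesis"
  proof (rule has_bochner_integral_cong)
    fix x assume "x \<in> space pos_lborel"
    hence x: "x > 0" by simp
    have "complex_of_real (a * x) powr (z - 1) = of_real a powr (z - 1) * of_real x powr (z - 1)"
      unfolding of_real_mult using x assms by (intro powr_times_real) auto
    moreover have "of_real a * complex_of_real a powr (z - 1) = of_real a powr z"
      using assms by (simp add: powr_diff)
    ultimately show "(a *\<^sub>R ?f (a * x)) / of_real a powr z = of_real x powr (z - 1) * of_real (exp (- (a * x)))"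
      using assms by (simp add: scaleR_conv_of_real field_simps del: of_real_mult)
  qed auto
  finally show ?thesis .
qed

text \<open>Real exponents give the norms of the complex integrands, as needed for Fubini and for
  summation under the integral.\<close>

lemma has_bochner_integral_Gamma_real:
  assumes "z > 0" "a > 0"
  shows "has_bochner_integral pos_lborel (\<lambda>x. x powr (z - 1) * exp (- (a * x))) (Gamma z / a powr z)"
proof -
  have "has_bochner_integral pos_lborel
     (\<lambda>x. Re (of_real x powr (of_real z - 1) * of_real (exp (- (a * x)))))
     (Re (Gamma (of_real z) / of_real a powr of_real z))"
    using assms by (intro has_bochner_integral_Re has_bochner_integral_Gamma) auto
  also have "Re (Gamma (of_real z) / of_real a powr of_real z) = Gamma z / a powr z"
    using assms by (simp add: Gamma_complex_of_real powr_of_real Re_divide_of_real)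
  also have "has_bochner_integral pos_lborel
     (\<lambda>x. Re (of_real x powr (of_real z - 1) * of_real (exp (- (a * x))))) (Gamma z / a powr z) \<longleftrightarrow> ?thesis"
  proof (rule has_bochner_integral_cong)
    fix x assume "x \<in> space pos_lborel"
    hence "complex_of_real x powr (of_real z - 1) = of_real (x powr (z - 1))"
      using powr_of_real[of x "z - 1"] by simp
    thus "Re (of_real x powr (of_real z - 1) * of_real (exp (- (a * x)))) = x powr (z - 1) * exp (- (a * x))"
      by (simp only: Re_complex_of_real flip: of_real_mult)
  qed auto
  finally show ?thesis .
qed

text \<open>Writing 1 / (1 + u) as the integral of exp (- t (1 + u)) over t > 0 gives a double
  integral. Integrating over u first leaves Gamma z times t^(-z) exp (- t), and the integral over t
  then contributes Gamma (1 - z).\<close>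

lemma has_bochner_integral_powr_div_one_plus:
  assumes "0 < Re z" "Re z < 1"
  shows "has_bochner_integral pos_lborel (\<lambda>u. of_real u powr (z - 1) / of_real (1 + u))
           (Gamma z * Gamma (1 - z))"
proof -
  define F where "F = (\<lambda>(t, u). complex_of_real u powr (z - 1) * of_real (exp (- (t * u))) * of_real (exp (- t)))"
  have [measurable]: "F \<in> borel_measurable (pos_lborel \<Otimes>\<^sub>M pos_lborel)"
    unfolding F_def case_prod_beta by measurable
  have t: "has_bochner_integral pos_lborel (\<lambda>u. F (t, u)) (Gamma z * (of_real t powr - z * of_real (exp (- t))))"
    if "t > 0" for t
    using has_bochner_integral_mult_left[OF has_bochner_integral_Gamma[OF assms(1) that], of "of_real (exp (- t))"]
    by (simp add: F_def powr_minus divide_inverse mult_ac)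
  have tn: "has_bochner_integral pos_lborel (\<lambda>u. norm (F (t, u))) (Gamma (Re z) * (t powr - Re z * exp (- t)))"
    if "t > 0" for t
  proof -
    have "has_bochner_integral pos_lborel (\<lambda>u. (u powr (Re z - 1) * exp (- (t * u))) * exp (- t))
      (Gamma (Re z) / t powr Re z * exp (- t))"
      using assms that by (intro has_bochner_integral_mult_left has_bochner_integral_Gamma_real) auto
    also have "?this \<longleftrightarrow> has_bochner_integral pos_lborel (\<lambda>u. norm (F (t, u))) (Gamma (Re z) / t powr Re z * exp (- t))"
      by (rule has_bochner_integral_cong) (auto simp: F_def norm_mult norm_powr_real_powr simp del: of_real_exp)
    finally show ?thesis by (simp add: powr_minus divide_inverse mult_ac)
  qed
  have u: "has_bochner_integral pos_lborel (\<lambda>t. F (t, u)) (of_real u powr (z - 1) / of_real (1 + u))"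
    if "u > 0" for u
  proof -
    \<comment> \<open>The plain exponential integral is the Gamma integral at exponent 1; the factor
      \<open>t powr (1 - 1)\<close> is 1 for t > 0.\<close>
    have "has_bochner_integral pos_lborel
       (\<lambda>t. of_real u powr (z - 1) * (of_real t powr (1 - 1) * of_real (exp (- ((1 + u) * t)))))
       (of_real u powr (z - 1) * (Gamma 1 / of_real (1 + u) powr 1))"
      using that by (intro has_bochner_integral_mult_right has_bochner_integral_Gamma) auto
    also have "?this \<longleftrightarrow> has_bochner_integral pos_lborel (\<lambda>t. F (t, u))
       (of_real u powr (z - 1) * (Gamma 1 / of_real (1 + u) powr 1))"
    proof (rule has_bochner_integral_cong)
      fix t assume "t \<in> space pos_lborel"
      moreover have "exp (- ((1 + u) * t)) = exp (- (t * u)) * exp (- t)"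
        by (simp add: algebra_simps flip: exp_add)
      ultimately show "of_real u powr (z - 1) * (of_real t powr (1 - 1) * of_real (exp (- ((1 + u) * t)))) = F (t, u)"
        by (simp add: F_def mult_ac del: of_real_exp)
    qed auto
    finally show ?thesis using that by (simp add: Gamma_1 flip: of_real_add)
  qed
  have F: "integrable (pos_lborel \<Otimes>\<^sub>M pos_lborel) F"
  proof (rule pos_lborel_pair.Fubini_integrable)
    \<comment> \<open>The inner integral of the norm is Gamma (Re z) t^(-Re z) exp (- t), and Re z <
      1 makes it integrable at 0.\<close>
    have "integrable pos_lborel (\<lambda>t. Gamma (Re z) * (t powr ((1 - Re z) - 1) * exp (- (1 * t))))"
      using has_bochner_integral_Gamma_real[of "1 - Re z" 1] assms
      by (intro integrable_mult_right) (auto simp: has_bochner_integral_iff)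
    also have "?this \<longleftrightarrow> integrable pos_lborel (\<lambda>t. \<integral> u. norm (F (t, u)) \<partial>pos_lborel)"
      using tn by (intro Bochner_Integration.integrable_cong) (auto simp: has_bochner_integral_iff)
    finally show "integrable pos_lborel (\<lambda>t. \<integral> u. norm (F (t, u)) \<partial>pos_lborel)" .
    show "AE t in pos_lborel. integrable pos_lborel (\<lambda>u. F (t, u))"
      using t by (intro AE_I2) (auto simp: has_bochner_integral_iff)
  qed auto
  hence F': "integrable (pos_lborel \<Otimes>\<^sub>M pos_lborel) (\<lambda>(t, u). F (t, u))" by simp
  have "(\<integral>u. \<integral>t. F (t, u) \<partial>pos_lborel \<partial>pos_lborel) = (\<integral>t. \<integral>u. F (t, u) \<partial>pos_lborel \<partial>pos_lborel)"
    using pos_lborel_pair.Fubini_integral[of "\<lambda>t u. F (t, u)"] F' by simp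
  also have "\<dots> = (\<integral>t. Gamma z * (of_real t powr ((1 - z) - 1) * of_real (exp (- (1 * t)))) \<partial>pos_lborel)"
    using t by (intro Bochner_Integration.integral_cong) (auto simp: has_bochner_integral_iff)
  also have "\<dots> = Gamma z * Gamma (1 - z)"
    using has_bochner_integral_mult_right[OF has_bochner_integral_Gamma[of "1 - z" 1], of "Gamma z"] assms
    by (simp add: has_bochner_integral_iff)
  finally have 1: "(\<integral>u. \<integral>t. F (t, u) \<partial>pos_lborel \<partial>pos_lborel) = Gamma z * Gamma (1 - z)" .
  have 2: "integrable pos_lborel (\<lambda>u. \<integral>t. F (t, u) \<partial>pos_lborel)"
    using pos_lborel_pair.integrable_snd[of "\<lambda>t u. F (t, u)"] F' by simp
  have "has_bochner_integral pos_lborel (\<lambda>u. \<integral>t. F (t, u) \<partial>pos_lborel) (Gamma z * Gamma (1 - z))"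
    using 1 2 by (simp add: has_bochner_integral_iff)
  also have "?this \<longleftrightarrow> ?thesis"
    using u by (intro has_bochner_integral_cong) (auto simp: has_bochner_integral_iff)
  finally show ?thesis .
qed

text \<open>The substitution u = x^2 / a^2 with exponent w / 2 reduces this to the preceding
  integral, and the reflection formula turns its Gamma product into the sine.\<close>

lemma has_bochner_integral_Mellin_inverse_square:
  assumes "0 < Re w" "Re w < 2" "a > 0"
  shows "has_bochner_integral pos_lborel (\<lambda>x. of_real x powr (w - 1) / of_real (x\<^sup>2 + a\<^sup>2))
           (of_real pi / 2 * of_real a powr (w - 2) / sin (of_real pi * w / 2))"
proof -
  let ?f = "\<lambda>u. complex_of_real u powr (w / 2 - 1) / of_real (1 + u)"
  have eq: "(2 * x / a\<^sup>2) *\<^sub>R ?f (x\<^sup>2 / a\<^sup>2)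
      = of_real 2 * of_real a powr (2 - w) * (of_real x powr (w - 1) / of_real (x\<^sup>2 + a\<^sup>2))"
    if "x > 0" for x
  proof -
    have "complex_of_real (x\<^sup>2 / a\<^sup>2) = exp (of_real (2 * ln x - 2 * ln a))"
      using that assms by (simp add: exp_diff exp_double flip: of_real_exp)
    hence "complex_of_real (x\<^sup>2 / a\<^sup>2) powr (w / 2 - 1) = exp ((w - 2) * (of_real (ln x) - of_real (ln a)))"
      by (simp add: powr_def algebra_simps)
    also have "\<dots> = of_real x powr (w - 1) / of_real x * of_real a powr (2 - w)"
      using that assms
      by (simp add: powr_def Ln_of_real algebra_simps exp_diff exp_add exp_double power2_eq_square)
         (simp add: field_simps flip: of_real_exp)
    finally show ?thesis
      using that assms by (simp add: scaleR_conv_of_real divide_simps) (simp add: algebra_simps power2_eq_square)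
  qed
  have "has_bochner_integral pos_lborel ?f (Gamma (w / 2) * Gamma (1 - w / 2))"
    using assms by (intro has_bochner_integral_powr_div_one_plus) auto
  hence "has_bochner_integral pos_lborel (\<lambda>x. (2 * x / a\<^sup>2) *\<^sub>R ?f (x\<^sup>2 / a\<^sup>2)) (Gamma (w / 2) * Gamma (1 - w / 2))"
  proof (rule has_bochner_integral_pos_lborel_substitution[rotated -1])
    show "bij_betw (\<lambda>x. x\<^sup>2 / a\<^sup>2) {0<..} {0<..}"
      by (rule bij_betwI[where g = "\<lambda>x. a * sqrt x"])
         (use assms in \<open>auto simp: power_mult_distrib real_sqrt_divide\<close>)
    show "(\<lambda>x. (2 * x / a\<^sup>2) *\<^sub>R ?f (x\<^sup>2 / a\<^sup>2)) \<in> borel_measurable pos_lborel"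
      by (subst measurable_cong[OF eq]) (auto, measurable)
    show "((\<lambda>x. x\<^sup>2 / a\<^sup>2) has_real_derivative 2 * x / a\<^sup>2) (at x)" if "x > 0" for x
      by (auto intro!: derivative_eq_intros DERIV_cdivide)
  qed (use assms in auto)
  also have "?this \<longleftrightarrow> has_bochner_integral pos_lborel
     (\<lambda>x. of_real 2 * of_real a powr (2 - w) * (of_real x powr (w - 1) / of_real (x\<^sup>2 + a\<^sup>2)))
     (Gamma (w / 2) * Gamma (1 - w / 2))"
    by (rule has_bochner_integral_cong[OF refl eq]) auto
  finally have int: "has_bochner_integral pos_lborel
     (\<lambda>x. (of_real a powr (w - 2) / 2) *
        (of_real 2 * of_real a powr (2 - w) * (of_real x powr (w - 1) / of_real (x\<^sup>2 + a\<^sup>2))))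
     ((of_real a powr (w - 2) / 2) * (Gamma (w / 2) * Gamma (1 - w / 2)))"
    by (rule has_bochner_integral_mult_right)
  have c: "(of_real a powr (w - 2) / 2) * (of_real 2 * of_real a powr (2 - w) * X) = (X :: complex)" for X
  proof -
    have "of_real a powr (w - 2) * of_real a powr (2 - w) = (1 :: complex)"
      using assms by (simp flip: powr_add)
    hence "(of_real a powr (w - 2) * of_real a powr (2 - w)) * X = X" by simp
    thus ?thesis by (simp add: mult_ac)
  qed
  have g: "Gamma (w / 2) * Gamma (1 - w / 2) = of_real pi / sin (of_real pi * w / 2)"
    using Gamma_reflection_complex[of "w / 2"] by simp
  show ?thesis using int unfolding c g by (simp add: mult.commute)
qed

section \<open>Partial fractions of the tangent\<close>

text \<open>Taking the logarithmic derivative of Gamma (1/2 + w) Gamma (1/2 - w) = pi / cos (pi w)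
  equates a difference of Digamma values with pi tan (pi w); the series for Digamma then supplies
  the partial fractions.\<close>

lemma tan_partial_fractions:
  fixes w :: complex
  assumes "cos (of_real pi * w) \<noteq> 0" "w \<noteq> 0"
  shows "(\<lambda>n. 1 / ((of_nat n + 1 / 2)\<^sup>2 - w\<^sup>2)) sums (of_real pi * tan (of_real pi * w) / (2 * w))"
proof -
  have cos1: "sin (of_real pi * (1 / 2 + w)) = cos (of_real pi * w)"
    by (simp add: distrib_left sin_add)
  have cos2: "sin (of_real pi * (1 / 2 - w)) = cos (of_real pi * w)"
    by (simp add: right_diff_distrib sin_diff)
  have zero: "sin (of_real pi * z) = 0" if "z \<in> \<int>" for z :: complex
    using that by (elim Ints_cases) (auto simp: sin_eq_0 mult_ac intro!: exI)
  \<comment> \<open>As cos (pi w) is nonzero, 1/2 + w and 1/2 - w are not integers, so no pole of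
    Gamma is met and no denominator below vanishes.\<close>
  have ni1: "1 / 2 + w \<notin> \<int>" and ni2: "1 / 2 - w \<notin> \<int>"
    using zero[of "1 / 2 + w"] zero[of "1 / 2 - w"] assms cos1 cos2 by auto
  hence np: "1 / 2 + w \<notin> \<int>\<^sub>\<le>\<^sub>0" "1 / 2 - w \<notin> \<int>\<^sub>\<le>\<^sub>0"
    using nonpos_Ints_Int by blast+
  have refl: "Gamma (1 / 2 + w) * Gamma (1 / 2 - w) = of_real pi / cos (of_real pi * w)" for w :: complex
    using Gamma_reflection_complex[of "1 / 2 + w"] by (simp add: distrib_left sin_add)
  have "((\<lambda>w. Gamma (1 / 2 + w) * Gamma (1 / 2 - w)) has_field_derivative
      Gamma (1 / 2 + w) * Gamma (1 / 2 - w) * (Digamma (1 / 2 + w) - Digamma (1 / 2 - w))) (at w)"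
    using np by (auto intro!: derivative_eq_intros simp: algebra_simps)
  moreover have "((\<lambda>w. Gamma (1 / 2 + w) * Gamma (1 / 2 - w)) has_field_derivative
      of_real pi * (of_real pi * sin (of_real pi * w)) / (cos (of_real pi * w))\<^sup>2) (at w)"
    unfolding refl using assms by (auto intro!: derivative_eq_intros simp: power2_eq_square)
  ultimately have eq: "Gamma (1 / 2 + w) * Gamma (1 / 2 - w) * (Digamma (1 / 2 + w) - Digamma (1 / 2 - w)) =
      of_real pi * (of_real pi * sin (of_real pi * w)) / (cos (of_real pi * w))\<^sup>2"
    by (rule DERIV_unique)
  have dig: "Digamma (1 / 2 + w) - Digamma (1 / 2 - w) = of_real pi * tan (of_real pi * w)"
  proof -
    have "Digamma (1 / 2 + w) - Digamma (1 / 2 - w) = cos (of_real pi * w) / of_real pi *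
        (of_real pi / cos (of_real pi * w) * (Digamma (1 / 2 + w) - Digamma (1 / 2 - w)))"
      using assms by simp
    also have "\<dots> = of_real pi * tan (of_real pi * w)"
      using eq assms unfolding refl by (simp add: tan_def power2_eq_square)
    finally show ?thesis .
  qed
  have nz: "1 / 2 + w + of_nat n \<noteq> 0" "1 / 2 - w + of_nat n \<noteq> 0" for n
  proof -
    have "1 / 2 + w = of_int (- int n)" if "1 / 2 + w + of_nat n = 0"
      using that by (simp add: add_eq_0_iff)
    thus "1 / 2 + w + of_nat n \<noteq> 0" using ni1 by (metis Ints_of_int)
    have "1 / 2 - w = of_int (- int n)" if "1 / 2 - w + of_nat n = 0"
      using that by (simp add: add_eq_0_iff)
    thus "1 / 2 - w + of_nat n \<noteq> 0" using ni2 by (metis Ints_of_int)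
  qed
  have S: "(\<lambda>n. inverse (of_nat (Suc n)) - inverse (z + of_nat n)) sums (Digamma z + euler_mascheroni)"
    if "z \<noteq> 0" for z :: complex
    using summable_sums[OF summable_Digamma[OF that]] by (simp add: Digamma_def)
  \<comment> \<open>In the difference of the two Digamma series the terms 1 / (n + 1) and the Euler
    constants cancel.\<close>
  have "(\<lambda>n. inverse (1 / 2 - w + of_nat n) - inverse (1 / 2 + w + of_nat n)) sums
      (of_real pi * tan (of_real pi * w))"
    using sums_diff[OF S S, of "1 / 2 + w" "1 / 2 - w"] nz(1)[of 0] nz(2)[of 0] dig
    by simp
  hence "(\<lambda>n. (inverse (1 / 2 - w + of_nat n) - inverse (1 / 2 + w + of_nat n)) / (2 * w)) sums
      (of_real pi * tan (of_real pi * w) / (2 * w))"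
    by (rule sums_divide)
  moreover have "(inverse (1 / 2 - w + of_nat n) - inverse (1 / 2 + w + of_nat n)) / (2 * w) =
      1 / ((of_nat n + 1 / 2)\<^sup>2 - w\<^sup>2)" for n
  proof -
    have "(of_nat n + 1 / 2)\<^sup>2 - w\<^sup>2 = (1 / 2 - w + of_nat n) * (1 / 2 + w + of_nat n)"
      by (simp add: power2_eq_square algebra_simps)
    moreover have "inverse x - inverse y = (y - x) / (x * y)" if "x \<noteq> 0" "y \<noteq> 0" for x y :: complex
      using that by (simp add: field_simps)
    ultimately show ?thesis using nz[of n] assms by simp
  qed
  ultimately show ?thesis by simp
qed

lemma tan_partial_fractions_node:
  fixes z :: complex
  assumes "cos z \<noteq> 0" "z \<noteq> 0"
  shows "(\<lambda>n. 1 / ((of_real (node n))\<^sup>2 - z\<^sup>2)) sums (tan z / (2 * z))"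
proof -
  have "(\<lambda>n. 1 / ((of_nat n + 1 / 2)\<^sup>2 - (z / of_real pi)\<^sup>2) / (of_real pi)\<^sup>2) sums
     (of_real pi * tan z / (2 * (z / of_real pi)) / (of_real pi)\<^sup>2)"
    using tan_partial_fractions[of "z / of_real pi"] assms by (intro sums_divide) simp
  moreover have "1 / ((of_nat n + 1 / 2)\<^sup>2 - (z / of_real pi)\<^sup>2) / (of_real pi)\<^sup>2 =
     1 / ((of_real (node n))\<^sup>2 - z\<^sup>2)" for n
  proof -
    have "((of_nat n + 1 / 2)\<^sup>2 - (z / of_real pi)\<^sup>2) * (of_real pi)\<^sup>2 = (of_real (node n))\<^sup>2 - z\<^sup>2"
      by (simp add: node_def power_mult_distrib left_diff_distrib power_divide) 
    thus ?thesis by (metis divide_divide_eq_left)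
  qed
  ultimately show ?thesis by (simp add: power2_eq_square)
qed

section \<open>The expansion at real and at imaginary arguments\<close>

lemma cos_eq_0_node:
  assumes "cos y = 0" "y > 0"
  shows "\<exists>n. y = node n"
proof -
  obtain i where i: "y = of_int i * pi + pi / 2"
    using assms(1) cos_zero_iff_int2 by auto
  have "of_int i > (-1 :: real)"
  proof (rule ccontr)
    assume "\<not> of_int i > (-1 :: real)"
    hence "of_int i * pi \<le> -1 * pi" by (intro mult_right_mono) auto
    thus False using assms i pi_gt_zero by simp
  qed
  hence "i \<ge> 0" by linarith
  thus ?thesis using i by (intro exI[of _ "nat i"]) (simp add: node_def algebra_simps)
qed

lemma tan_node_sums:
  assumes "y > 0" "y \<notin> range node"
  shows "(\<lambda>n. 1 / ((node n)\<^sup>2 - y\<^sup>2)) sums (tan y / (2 * y))"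
proof -
  have "cos y \<noteq> 0" using cos_eq_0_node[of y] assms by auto
  hence "(\<lambda>n. 1 / ((of_real (node n))\<^sup>2 - (of_real y)\<^sup>2)) sums (tan (of_real y) / (2 * of_real y) :: complex)"
    using assms by (intro tan_partial_fractions_node) (auto simp: cos_of_real)
  hence "(\<lambda>n. complex_of_real (1 / ((node n)\<^sup>2 - y\<^sup>2))) sums of_real (tan y / (2 * y))"
    by (simp add: tan_of_real)
  thus ?thesis by (subst (asm) sums_of_real_iff)
qed

text \<open>Evaluation of the complex expansion at i x: the square changes sign, and tan (i x) = i
  tanh x.\<close>

lemma tanh_node_sums:
  assumes "x > 0"
  shows "(\<lambda>n. 1 / ((node n)\<^sup>2 + x\<^sup>2)) sums (tanh x / (2 * x))"
proof -
  have c: "cos (\<i> * of_real x) = of_real (cosh x)"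
    by (simp add: cosh_def exp_of_real scaleR_conv_of_real flip: cosh_conv_cos of_real_minus)
  have s: "sin (\<i> * of_real x) = \<i> * of_real (sinh x)"
    using sinh_conv_sin[of "of_real x"] by (simp add: sinh_def exp_of_real scaleR_conv_of_real flip: of_real_minus)
  have "(\<lambda>n. 1 / ((of_real (node n))\<^sup>2 - (\<i> * of_real x)\<^sup>2)) sums (tan (\<i> * of_real x) / (2 * (\<i> * of_real x)))"
    using assms c by (intro tan_partial_fractions_node) auto
  moreover have "tan (\<i> * of_real x) = \<i> * of_real (tanh x)"
    by (simp add: tan_def c s tanh_def)
  ultimately have "(\<lambda>n. complex_of_real (1 / ((node n)\<^sup>2 + x\<^sup>2))) sums of_real (tanh x / (2 * x))"
    by (simp add: power_mult_distrib)
  thus ?thesis by (subst (asm) sums_of_real_iff)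
qed

section \<open>An integral representation of the difference\<close>

text \<open>Summable L1 norms justify the interchange. The first conclusion evaluates an integral by
  a known series, as for eta; the second evaluates a series by a known integral, as for the
  nodes.\<close>

lemma has_bochner_integral_sums:
  fixes f :: "nat \<Rightarrow> 'a \<Rightarrow> 'b :: {banach, second_countable_topology}"
  assumes f: "\<And>n. has_bochner_integral M (f n) (I n)"
    and norm_f: "\<And>n. has_bochner_integral M (\<lambda>x. norm (f n x)) (J n)"
    and J: "summable J"
    and summable: "\<And>x. x \<in> space M \<Longrightarrow> summable (\<lambda>n. norm (f n x))"
    and sums: "\<And>x. x \<in> space M \<Longrightarrow> (\<lambda>n. f n x) sums F x"
  shows "has_bochner_integral M F (suminf I)" "I sums integral\<^sup>L M F"
proof -
  have int: "integrable M (f n)" "integral\<^sup>L M (f n) = I n" "(\<integral>x. norm (f n x) \<partial>M) = J n" for n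
    using f[of n] norm_f[of n] by (auto simp: has_bochner_integral_iff)
  have 1: "integrable M (\<lambda>x. \<Sum>n. f n x)"
    using int J summable by (intro integrable_suminf) auto
  have 2: "I sums (\<integral>x. (\<Sum>n. f n x) \<partial>M)"
    using sums_integral[of M f] int J summable by simp
  have F: "(\<Sum>n. f n x) = F x" if "x \<in> space M" for x
    using sums[OF that] by (simp add: sums_iff)
  have "integrable M F" using 1 F by (simp cong: Bochner_Integration.integrable_cong)
  moreover show "I sums integral\<^sup>L M F" using 2 F by (simp cong: Bochner_Integration.integral_cong)
  ultimately show "has_bochner_integral M F (suminf I)" by (simp add: has_bochner_integral_iff sums_iff)
qed

section \<open>The Mellin transform of 1 - tanh\<close>

lemma one_minus_tanh_eq: "1 - tanh x = 2 * exp (- (2 * x)) / (1 + exp (- (2 * x)))" for x :: real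
proof -
  have "1 + exp (- (2 * x)) \<noteq> 0" by (smt (verit) exp_gt_zero)
  thus ?thesis by (simp add: tanh_real_altdef field_simps)
qed

text \<open>With q = exp (- 2 x) the function is 2 q / (1 + q), an alternating geometric series,
  paired here in the same way as \<open>dirichlet_eta\<close>. The pairs q^(2n+1) - q^(2n+2) are
  geometric with ratio q^2.\<close>

lemma one_minus_tanh_sums:
  fixes x :: real
  assumes "x > 0"
  shows "(\<lambda>n. 2 * (exp (- (2 * (2 * real n + 1) * x)) - exp (- (2 * (2 * real n + 2) * x)))) sums (1 - tanh x)"
proof -
  define q where "q = exp (- (2 * x))"
  have q: "0 < q" "q < 1" using assms by (auto simp: q_def)
  have pow: "exp (- (2 * real k * x)) = q ^ k" for k
    by (simp add: q_def mult_ac flip: exp_of_nat_mult)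
  have q_pow: "q ^ (2 * n + 1) = q * (q\<^sup>2) ^ n" "q ^ (2 * n + 2) = q\<^sup>2 * (q\<^sup>2) ^ n" for n
    by (simp_all add: power_add power_mult) (simp add: power2_eq_square)
  have e: "exp (- (2 * (2 * real n + 1) * x)) = q * (q\<^sup>2) ^ n" "exp (- (2 * (2 * real n + 2) * x)) = q\<^sup>2 * (q\<^sup>2) ^ n" for n
    using pow[of "2 * n + 1", unfolded q_pow] pow[of "2 * n + 2", unfolded q_pow] by (simp_all add: mult_ac add_ac)
  have "q\<^sup>2 < 1" using q by (simp add: power_less_one_iff)
  hence "(\<lambda>n. 2 * (q - q\<^sup>2) * (q\<^sup>2) ^ n) sums (2 * (q - q\<^sup>2) * (1 / (1 - q\<^sup>2)))"
    using q by (intro sums_mult geometric_sums) auto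
  also have "2 * (q - q\<^sup>2) * (1 / (1 - q\<^sup>2)) = 2 * q / (1 + q)"
  proof -
    have "1 - q\<^sup>2 = (1 - q) * (1 + q)" "q - q\<^sup>2 = (1 - q) * q" by (simp_all add: power2_eq_square algebra_simps)
    thus ?thesis using q by simp
  qed
  also have "\<dots> = 1 - tanh x" unfolding one_minus_tanh_eq q_def ..
  finally show ?thesis unfolding e by (simp add: algebra_simps)
qed

text \<open>For Re s \<le> 1 the norm integrals of the single exponentials are not summable. A pair
  is nonnegative, so the integral of its norm is, up to a constant factor, the pair of the eta
  series at the real point Re s, and these are summable for every Re s > 0.\<close>

lemma dirichlet_eta_Mellin:
  assumes "Re s > 0"
  shows "has_bochner_integral pos_lborel (\<lambda>x. of_real x powr (s - 1) * of_real (1 - tanh x))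
           (2 powr (1 - s) * Gamma s * dirichlet_eta s)"
proof -
  define e where "e = (\<lambda>n x. 2 * (exp (- (2 * (2 * real n + 1) * x)) - exp (- (2 * (2 * real n + 2) * x))))"
  define I where "I = (\<lambda>n. 2 * (Gamma s / of_real (2 * (2 * real n + 1)) powr s - Gamma s / of_real (2 * (2 * real n + 2)) powr s))"
  define J where "J = (\<lambda>n. 2 * (Gamma (Re s) / (2 * (2 * real n + 1)) powr Re s - Gamma (Re s) / (2 * (2 * real n + 2)) powr Re s))"
  \<comment> \<open>Stated for general \<open>z\<close> and \<open>G\<close> so that it applies to
    \<open>I\<close> at s and, after embedding into the complex numbers, to \<open>J\<close> at Re
    s.\<close>
  have I_eq: "I n = 2 powr (1 - z) * G * (of_real (2 * real n + 1) powr - z - of_real (2 * real n + 2) powr - z)"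
    if "I = (\<lambda>n. 2 * (G / of_real (2 * (2 * real n + 1)) powr z - G / of_real (2 * (2 * real n + 2)) powr z))"
    for I and z G :: complex and n
  proof -
    have h: "complex_of_real (2 * t) powr z = 2 powr z * of_real t powr z" if "t > 0" for t
      using powr_times_real[of 2 "of_real t" z] that by simp
    have "2 * inverse (2 powr z) = (2 powr (1 - z) :: complex)"
      by (simp add: powr_diff divide_inverse)
    moreover have "I n = 2 * inverse (2 powr z) * G * (of_real (2 * real n + 1) powr - z - of_real (2 * real n + 2) powr - z)"
      unfolding that by (subst (1 2) h) (simp_all add: powr_minus divide_inverse algebra_simps del: of_real_add of_real_mult)
    ultimately show ?thesis by simp
  qed
  have e_nonneg: "e n x \<ge> 0" if "x > 0" for n x
    using that by (simp add: e_def mult_right_mono)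
  have norm_eq: "norm (complex_of_real x powr (s - 1) * of_real (e n x)) = x powr (Re s - 1) * e n x" if "x > 0" for n x
    using that e_nonneg[of x n] by (simp add: norm_mult norm_powr_real_powr)
  have e_sums: "(\<lambda>n. e n x) sums (1 - tanh x)" if "x > 0" for x
    using one_minus_tanh_sums[OF that] by (simp add: e_def)
  have "has_bochner_integral pos_lborel (\<lambda>x. of_real x powr (s - 1) * of_real (1 - tanh x)) (suminf I)"
  proof (rule has_bochner_integral_sums)
    fix n
    have "has_bochner_integral pos_lborel (\<lambda>x. 2 * (of_real x powr (s - 1) * of_real (exp (- (2 * (2 * real n + 1) * x))) -
        of_real x powr (s - 1) * of_real (exp (- (2 * (2 * real n + 2) * x))))) (I n)"
      unfolding I_def using assms
      by (intro has_bochner_integral_mult_right has_bochner_integral_diff has_bochner_integral_Gamma) auto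
    thus "has_bochner_integral pos_lborel (\<lambda>x. of_real x powr (s - 1) * of_real (e n x)) (I n)"
      by (simp add: e_def algebra_simps)
    have "has_bochner_integral pos_lborel (\<lambda>x. 2 * (x powr (Re s - 1) * exp (- (2 * (2 * real n + 1) * x)) -
        x powr (Re s - 1) * exp (- (2 * (2 * real n + 2) * x)))) (J n)"
      unfolding J_def using assms
      by (intro has_bochner_integral_mult_right has_bochner_integral_diff has_bochner_integral_Gamma_real) auto
    also have "?this \<longleftrightarrow> has_bochner_integral pos_lborel (\<lambda>x. norm (complex_of_real x powr (s - 1) * of_real (e n x))) (J n)"
      by (intro has_bochner_integral_cong refl) (simp add: norm_eq, simp add: e_def algebra_simps)
    finally show \<dots> .
  next
    have "(\<lambda>n. complex_of_real (J n)) = (\<lambda>n. 2 * (of_real (Gamma (Re s)) / of_real (2 * (2 * real n + 1)) powr of_real (Re s)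
        - of_real (Gamma (Re s)) / of_real (2 * (2 * real n + 2)) powr of_real (Re s)))"
      by (rule ext) (simp add: J_def del: of_real_add of_real_mult flip: powr_of_real, simp)
    from I_eq[OF this] have "summable (\<lambda>n. complex_of_real (J n))"
      using summable_dirichlet_eta[of "of_real (Re s)"] assms by (auto intro!: summable_mult)
    thus "summable J" by (subst (asm) summable_of_real_iff)
  next
    fix x assume "x \<in> space pos_lborel"
    hence x: "x > 0" by simp
    show "summable (\<lambda>n. norm (complex_of_real x powr (s - 1) * of_real (e n x)))"
      unfolding norm_eq[OF x] using e_sums[OF x] by (intro summable_mult) (simp add: sums_iff)
    show "(\<lambda>n. complex_of_real x powr (s - 1) * of_real (e n x)) sums (of_real x powr (s - 1) * of_real (1 - tanh x))"
      using e_sums[OF x] by (intro sums_mult) (simp only: sums_of_real_iff)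
  qed
  also have "suminf I = 2 powr (1 - s) * Gamma s * dirichlet_eta s"
    unfolding I_eq[OF I_def, abs_def] dirichlet_eta_def by (rule suminf_mult[OF summable_dirichlet_eta[OF assms]])
  finally show ?thesis .
qed

lemma has_bochner_integral_Mellin_inverse_square_real:
  assumes "0 < w" "w < 2" "a > 0"
  shows "has_bochner_integral pos_lborel (\<lambda>x. x powr (w - 1) / (x\<^sup>2 + a\<^sup>2))
           (pi / 2 * a powr (w - 2) / sin (pi * w / 2))"
proof -
  have "has_bochner_integral pos_lborel (\<lambda>x. Re (of_real x powr (of_real w - 1) / of_real (x\<^sup>2 + a\<^sup>2)))
     (Re (of_real pi / 2 * of_real a powr (of_real w - 2) / sin (of_real pi * of_real w / 2)))"
    using assms by (intro has_bochner_integral_Re has_bochner_integral_Mellin_inverse_square) auto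
  also have "of_real pi / 2 * of_real a powr (of_real w - 2) / sin (of_real pi * of_real w / 2) =
      complex_of_real (pi / 2 * a powr (w - 2) / sin (pi * w / 2))"
    using assms powr_of_real[of a "w - 2"] by (simp flip: sin_of_real)
  also have "has_bochner_integral pos_lborel (\<lambda>x. Re (of_real x powr (of_real w - 1) / of_real (x\<^sup>2 + a\<^sup>2)))
     (Re (of_real (pi / 2 * a powr (w - 2) / sin (pi * w / 2)))) \<longleftrightarrow> ?thesis"
  proof (rule has_bochner_integral_cong)
    fix x assume "x \<in> space pos_lborel"
    hence "complex_of_real x powr (of_real w - 1) = of_real (x powr (w - 1))"
      using powr_of_real[of x "w - 1"] by simp
    thus "Re (of_real x powr (of_real w - 1) / of_real (x\<^sup>2 + a\<^sup>2)) = x powr (w - 1) / (x\<^sup>2 + a\<^sup>2)"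
      by (simp only: Re_complex_of_real flip: of_real_divide)
  qed auto
  finally show ?thesis .
qed

section \<open>Summation of the node series\<close>

lemma node_pos: "node n > 0"
  by (simp add: node_def add_nonneg_pos)

lemma filterlim_node: "filterlim node at_top sequentially"
proof (rule filterlim_at_top_mono[OF filterlim_real_sequentially always_eventually], rule allI)
  fix n
  have "1 * real n \<le> pi * real n" using pi_gt3 by (intro mult_right_mono) auto
  thus "real n \<le> node n" unfolding node_def distrib_left using pi_gt_zero by linarith
qed

text \<open>The real part is cos (pi Re s / 2) cosh (pi Im s / 2), and both factors are positive in
  the strip.\<close>

lemma cos_half_pi_nonzero:
  assumes "0 < Re s" "Re s < 1"
  shows "cos (of_real pi * s / 2) \<noteq> 0"
proof
  assume "cos (of_real pi * s / 2) = 0"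
  hence "Re (cos (of_real pi * s / 2)) = 0" by simp
  hence *: "cos (pi * Re s / 2) * (exp (pi * Im s / 2) + exp (- (pi * Im s / 2))) = 0"
    by (auto simp: Re_cos add_ac)
  have "cos (pi * Re s / 2) > 0" using assms by (intro cos_gt_zero) auto
  moreover have "exp (pi * Im s / 2) + exp (- (pi * Im s / 2)) > 0" by (intro add_pos_pos) auto
  ultimately show False using * by simp
qed

lemma tanh_Mellin_integrable:
  assumes "0 < Re s" "Re s < 2" "y > 0"
  shows "integrable pos_lborel (\<lambda>x. of_real x powr (s - 1) * of_real (tanh x) / of_real (x\<^sup>2 + y\<^sup>2))"
proof (rule Bochner_Integration.integrable_bound)
  show "integrable pos_lborel (\<lambda>x. complex_of_real x powr (s - 1) / of_real (x\<^sup>2 + y\<^sup>2))"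
    using has_bochner_integral_Mellin_inverse_square[OF assms] by (simp add: has_bochner_integral_iff)
  have "(\<lambda>x::real. complex_of_real (tanh x)) \<in> borel_measurable pos_lborel"
    by (intro borel_measurable_pos_lborel_continuous continuous_intros) auto
  thus "(\<lambda>x. of_real x powr (s - 1) * of_real (tanh x) / of_real (x\<^sup>2 + y\<^sup>2) :: complex) \<in> borel_measurable pos_lborel"
    by measurable
  show "AE x in pos_lborel. norm (of_real x powr (s - 1) * of_real (tanh x) / of_real (x\<^sup>2 + y\<^sup>2) :: complex)
      \<le> norm (complex_of_real x powr (s - 1) / of_real (x\<^sup>2 + y\<^sup>2))"
  proof (rule AE_I2)
    fix x :: real
    have "\<bar>tanh x\<bar> \<le> 1" using tanh_real_lt_1[of x] tanh_real_gt_neg1[of x] by linarith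
    hence "norm (complex_of_real x powr (s - 1)) * \<bar>tanh x\<bar> / \<bar>x\<^sup>2 + y\<^sup>2\<bar> \<le> norm (complex_of_real x powr (s - 1)) * 1 / \<bar>x\<^sup>2 + y\<^sup>2\<bar>"
      by (intro divide_right_mono mult_left_mono) auto
    thus "norm (of_real x powr (s - 1) * of_real (tanh x) / of_real (x\<^sup>2 + y\<^sup>2) :: complex)
      \<le> norm (complex_of_real x powr (s - 1) / of_real (x\<^sup>2 + y\<^sup>2))"
      by (simp only: norm_mult norm_divide norm_of_real mult_1_right)
  qed
qed

text \<open>The Mellin integral at w = s + 1 represents a^(s-1) for a node a, its sine being cos (pi
  s / 2). The identity 1 / ((x^2 + a^2) (y^2 - a^2)) = (1 / (a^2 + x^2) - 1 / (a^2 - y^2)) / (x^2 +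
  y^2) then splits the sum over the nodes into the expansions of tanh x and tan y.\<close>

lemma node_series_sums:
  fixes s :: complex
  assumes s: "0 < Re s" "Re s < 1" and y: "y > 0" "y \<notin> range node"
  shows "(\<lambda>n. of_real (node n) powr (s - 1) / of_real (y\<^sup>2 - (node n)\<^sup>2)) sums
     (cos (of_real pi * s / 2) / of_real pi *
        (\<integral>x. of_real x powr (s - 1) * of_real (tanh x) / of_real (x\<^sup>2 + y\<^sup>2) \<partial>pos_lborel)
      - of_real y powr (s - 2) * of_real (tan y) / 2)"
proof -
  define c where "c = cos (of_real pi * s / 2)"
  define C where "C = pi / 2 / sin (pi * (Re s + 1) / 2)"
  define f where "f = (\<lambda>n x. complex_of_real x powr s / of_real (x\<^sup>2 + (node n)\<^sup>2) / of_real (y\<^sup>2 - (node n)\<^sup>2))"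
  define F where "F = (\<lambda>x. of_real x powr s / of_real (x\<^sup>2 + y\<^sup>2) * complex_of_real (tanh x / (2 * x) - tan y / (2 * y)))"
  define J where "J = (\<integral>x. of_real x powr (s - 1) * complex_of_real (tanh x) / of_real (x\<^sup>2 + y\<^sup>2) \<partial>pos_lborel)"
  have c: "c \<noteq> 0" unfolding c_def by (rule cos_half_pi_nonzero[OF s])
  have sin_c: "sin (of_real pi * (s + 1) / 2) = c"
    by (simp add: c_def distrib_left add_divide_distrib sin_add)
  have Mellin: "has_bochner_integral pos_lborel (\<lambda>x. of_real x powr s / of_real (x\<^sup>2 + a\<^sup>2))
      (of_real pi / 2 * of_real a powr (s - 1) / c)" if "a > 0" for a
    using has_bochner_integral_Mellin_inverse_square[of "s + 1" a] s that sin_c by simp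
  have y_node: "y\<^sup>2 \<noteq> (node n)\<^sup>2" for n
    using y node_pos[of n] by (auto simp: power2_eq_iff)
  have tan: "(\<lambda>n. 1 / ((node n)\<^sup>2 - y\<^sup>2)) sums (tan y / (2 * y))"
    using y by (rule tan_node_sums)
  \<comment> \<open>The finitely many nodes below y give terms of the other sign, so this equality
    is claimed only from some index on.\<close>
  have ev: "eventually (\<lambda>n. norm (1 / (y\<^sup>2 - (node n)\<^sup>2)) = 1 / ((node n)\<^sup>2 - y\<^sup>2)) sequentially"
    using filterlim_at_top_dense[THEN iffD1, OF filterlim_node, rule_format, of y]
  proof eventually_elim
    case (elim n)
    hence "y\<^sup>2 < (node n)\<^sup>2" using y by (intro power_strict_mono) auto
    thus ?case by simp
  qed
  have abs_sum: "summable (\<lambda>n. norm (1 / (y\<^sup>2 - (node n)\<^sup>2)))"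
    using tan by (subst summable_cong[OF ev]) (simp add: sums_iff)
  have sums: "(\<lambda>n. f n x) sums F x" and summable: "summable (\<lambda>n. norm (f n x))" if x: "x > 0" for x
  proof -
    have pos: "x\<^sup>2 + (node n)\<^sup>2 > 0" "x\<^sup>2 + y\<^sup>2 > 0" for n using x y by (auto intro: add_pos_nonneg)
    have "(\<lambda>n. 1 / ((node n)\<^sup>2 + x\<^sup>2) - 1 / ((node n)\<^sup>2 - y\<^sup>2)) sums (tanh x / (2 * x) - tan y / (2 * y))"
      by (intro sums_diff tan tanh_node_sums x)
    hence "(\<lambda>n. of_real x powr s / of_real (x\<^sup>2 + y\<^sup>2) * complex_of_real (1 / ((node n)\<^sup>2 + x\<^sup>2) - 1 / ((node n)\<^sup>2 - y\<^sup>2))) sums F x"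
      unfolding F_def by (intro sums_mult) (simp only: sums_of_real_iff)
    moreover have "of_real x powr s / of_real (x\<^sup>2 + y\<^sup>2) * complex_of_real (1 / ((node n)\<^sup>2 + x\<^sup>2) - 1 / ((node n)\<^sup>2 - y\<^sup>2)) = f n x" for n
    proof -
      have "1 / ((node n)\<^sup>2 + x\<^sup>2) - 1 / ((node n)\<^sup>2 - y\<^sup>2) = (x\<^sup>2 + y\<^sup>2) / ((x\<^sup>2 + (node n)\<^sup>2) * (y\<^sup>2 - (node n)\<^sup>2))"
      proof -
        have "1 / A - 1 / (- B) = (A + B) / (A * B)" if "A \<noteq> 0" "B \<noteq> 0" for A B :: real
          using that by (simp add: field_simps)
        from this[of "x\<^sup>2 + (node n)\<^sup>2" "y\<^sup>2 - (node n)\<^sup>2"] show ?thesis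
          using pos(1)[of n] y_node[of n] x by (simp add: add.commute)
      qed
      hence "complex_of_real (1 / ((node n)\<^sup>2 + x\<^sup>2) - 1 / ((node n)\<^sup>2 - y\<^sup>2)) =
          of_real (x\<^sup>2 + y\<^sup>2) / (of_real (x\<^sup>2 + (node n)\<^sup>2) * of_real (y\<^sup>2 - (node n)\<^sup>2))"
        by (simp only: of_real_divide of_real_mult)
      moreover have "complex_of_real (x\<^sup>2 + y\<^sup>2) \<noteq> 0" using pos(2) by (simp only: of_real_eq_0_iff)
      ultimately show ?thesis by (simp only: f_def) (simp del: of_real_add of_real_diff of_real_power)
    qed
    ultimately show "(\<lambda>n. f n x) sums F x" by simp
    show "summable (\<lambda>n. norm (f n x))"
    proof (rule summable_comparison_test')
      show "summable (\<lambda>n. norm (complex_of_real x powr s) / x\<^sup>2 * norm (1 / (y\<^sup>2 - (node n)\<^sup>2)))"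
        by (intro summable_mult abs_sum)
      fix n
      have "norm (f n x) = norm (complex_of_real x powr s) / (x\<^sup>2 + (node n)\<^sup>2) * norm (1 / (y\<^sup>2 - (node n)\<^sup>2))"
        using pos(1)[of n] unfolding f_def norm_divide norm_of_real by simp
      also have "\<dots> \<le> norm (complex_of_real x powr s) / x\<^sup>2 * norm (1 / (y\<^sup>2 - (node n)\<^sup>2))"
        using x by (intro mult_right_mono divide_left_mono mult_pos_pos) (auto intro: add_pos_nonneg)
      finally show "norm (norm (f n x)) \<le> norm (complex_of_real x powr s) / x\<^sup>2 * norm (1 / (y\<^sup>2 - (node n)\<^sup>2))" by simp
    qed
  qed
  have I_sums: "(\<lambda>n. of_real pi / 2 * of_real (node n) powr (s - 1) / c / of_real (y\<^sup>2 - (node n)\<^sup>2)) sums integral\<^sup>L pos_lborel F"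
  proof (rule has_bochner_integral_sums(2))
    fix n
    show "has_bochner_integral pos_lborel (f n) (of_real pi / 2 * of_real (node n) powr (s - 1) / c / of_real (y\<^sup>2 - (node n)\<^sup>2))"
      unfolding f_def by (intro has_bochner_integral_divide_zero Mellin node_pos)
    have "has_bochner_integral pos_lborel (\<lambda>x. x powr ((Re s + 1) - 1) / (x\<^sup>2 + (node n)\<^sup>2) / \<bar>y\<^sup>2 - (node n)\<^sup>2\<bar>)
       (pi / 2 * node n powr ((Re s + 1) - 2) / sin (pi * (Re s + 1) / 2) / \<bar>y\<^sup>2 - (node n)\<^sup>2\<bar>)"
      using s by (intro has_bochner_integral_divide_zero has_bochner_integral_Mellin_inverse_square_real node_pos) auto
    also have "pi / 2 * node n powr ((Re s + 1) - 2) / sin (pi * (Re s + 1) / 2) / \<bar>y\<^sup>2 - (node n)\<^sup>2\<bar> =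
        C * node n powr (Re s - 1) * norm (1 / (y\<^sup>2 - (node n)\<^sup>2))"
      by (simp add: C_def)
    also have "has_bochner_integral pos_lborel (\<lambda>x. x powr ((Re s + 1) - 1) / (x\<^sup>2 + (node n)\<^sup>2) / \<bar>y\<^sup>2 - (node n)\<^sup>2\<bar>) \<dots> \<longleftrightarrow>
        has_bochner_integral pos_lborel (\<lambda>x. norm (f n x)) \<dots>"
      unfolding f_def norm_divide norm_of_real
      by (intro has_bochner_integral_cong refl) (auto simp: norm_powr_real_powr)
    finally show "has_bochner_integral pos_lborel (\<lambda>x. norm (f n x)) (C * node n powr (Re s - 1) * norm (1 / (y\<^sup>2 - (node n)\<^sup>2)))" .
  next
    show "summable (\<lambda>n. C * node n powr (Re s - 1) * norm (1 / (y\<^sup>2 - (node n)\<^sup>2)))"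
    proof (rule summable_comparison_test')
      \<comment> \<open>As Re s - 1 < 0, the powers of the nodes are largest at
        \<open>node 0\<close>; what remains is the absolutely convergent series for tan y.\<close>
      show "summable (\<lambda>n. \<bar>C\<bar> * node 0 powr (Re s - 1) * norm (1 / (y\<^sup>2 - (node n)\<^sup>2)))"
        by (intro summable_mult abs_sum)
      fix n
      have "node 0 \<le> node n" by (simp add: node_def)
      hence "node n powr (Re s - 1) \<le> node 0 powr (Re s - 1)"
        using s node_pos[of 0] by (intro powr_mono2') auto
      hence "\<bar>C\<bar> * node n powr (Re s - 1) * norm (1 / (y\<^sup>2 - (node n)\<^sup>2)) \<le> \<bar>C\<bar> * node 0 powr (Re s - 1) * norm (1 / (y\<^sup>2 - (node n)\<^sup>2))"
        by (intro mult_right_mono mult_left_mono) auto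
      thus "norm (C * node n powr (Re s - 1) * norm (1 / (y\<^sup>2 - (node n)\<^sup>2))) \<le> \<bar>C\<bar> * node 0 powr (Re s - 1) * norm (1 / (y\<^sup>2 - (node n)\<^sup>2))"
        by (simp add: abs_mult)
    qed
  qed (use sums summable in auto)
  \<comment> \<open>The two parts of \<open>F\<close>: dividing x^s tanh x by 2 x lowers the
    exponent to s - 1, and the part with tan y is again the Mellin integral at s + 1, now with a =
    y.\<close>
  have "has_bochner_integral pos_lborel
      (\<lambda>x. of_real x powr (s - 1) * of_real (tanh x) / of_real (x\<^sup>2 + y\<^sup>2) / 2
          - of_real x powr s / of_real (x\<^sup>2 + y\<^sup>2) * of_real (tan y / (2 * y)))
      (J / 2 - of_real pi / 2 * of_real y powr (s - 1) / c * of_real (tan y / (2 * y)))"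
    using tanh_Mellin_integrable[of s y] s y
    by (intro has_bochner_integral_diff has_bochner_integral_divide_zero has_bochner_integral_mult_left Mellin)
       (auto simp: J_def has_bochner_integral_iff)
  also have "?this \<longleftrightarrow> has_bochner_integral pos_lborel F
      (J / 2 - of_real pi / 2 * of_real y powr (s - 1) / c * of_real (tan y / (2 * y)))"
  proof (rule has_bochner_integral_cong)
    fix x assume "x \<in> space pos_lborel"
    hence "complex_of_real x powr (s - 1) = of_real x powr s / of_real x" by (simp add: powr_diff)
    thus "of_real x powr (s - 1) * of_real (tanh x) / of_real (x\<^sup>2 + y\<^sup>2) / 2
          - of_real x powr s / of_real (x\<^sup>2 + y\<^sup>2) * of_real (tan y / (2 * y)) = F x"
      by (simp add: F_def diff_divide_distrib right_diff_distrib mult_ac)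
  qed auto
  finally have "integral\<^sup>L pos_lborel F = J / 2 - of_real pi / 2 * of_real y powr (s - 1) / c * of_real (tan y / (2 * y))"
    by (simp add: has_bochner_integral_iff)
  with I_sums have "(\<lambda>n. 2 * c / of_real pi * (of_real pi / 2 * of_real (node n) powr (s - 1) / c / of_real (y\<^sup>2 - (node n)\<^sup>2))) sums
      (2 * c / of_real pi * (J / 2 - of_real pi / 2 * of_real y powr (s - 1) / c * of_real (tan y / (2 * y))))"
    by (intro sums_mult) simp
  moreover have "2 * c / of_real pi * (of_real pi / 2 * X / c / Y) = X / Y" for X Y
    using c by simp
  moreover have "2 * c / of_real pi * (J / 2 - of_real pi / 2 * of_real y powr (s - 1) / c * of_real (tan y / (2 * y))) =
      c / of_real pi * J - of_real y powr (s - 2) * of_real (tan y) / 2"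
  proof -
    have "complex_of_real y powr (s - 1) = of_real y powr (s - 2) * of_real y"
      using y powr_add[of "of_real y" "s - 2" 1] by simp
    thus ?thesis using c y by (simp add: right_diff_distrib)
  qed
  ultimately show ?thesis by (simp add: c_def J_def)
qed

text \<open>The last factor lies in [0, 1] and tends to 1 as |y| grows. This gives a uniform bound
  and, at infinity, the Mellin transform of 1 - tanh as the limit.\<close>

definition tanh_transform :: "complex \<Rightarrow> real \<Rightarrow> complex" where
  "tanh_transform s y = (\<integral>x. of_real x powr (s - 1) * of_real (1 - tanh x) * of_real (y\<^sup>2 / (x\<^sup>2 + y\<^sup>2)) \<partial>pos_lborel)"

lemma f1_minus_g1_pos:
  assumes s: "0 < Re s" "Re s < 1" and y: "y > 0" "y \<notin> range node"
  shows "f1 s y - g1 s y = 2 powr (s - 1) * of_real (cos y) * tanh_transform s y"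
proof -
  define c where "c = cos (of_real pi * s / 2)"
  define S where "S = sin (of_real pi * s / 2)"
  define J where "J = (\<integral>x. of_real x powr (s - 1) * complex_of_real (tanh x) / of_real (x\<^sup>2 + y\<^sup>2) \<partial>pos_lborel)"
  have c: "c \<noteq> 0" unfolding c_def by (rule cos_half_pi_nonzero[OF s])
  have cosy: "cos y \<noteq> 0" using cos_eq_0_node[of y] y by auto
  have "has_bochner_integral pos_lborel
      (\<lambda>x. of_real (y\<^sup>2) * (of_real x powr (s - 1) / of_real (x\<^sup>2 + y\<^sup>2) - of_real x powr (s - 1) * of_real (tanh x) / of_real (x\<^sup>2 + y\<^sup>2)))
      (of_real (y\<^sup>2) * (of_real pi / 2 * of_real y powr (s - 2) / S - J))"
    unfolding S_def using tanh_Mellin_integrable[of s y] s y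
    by (intro has_bochner_integral_mult_right has_bochner_integral_diff has_bochner_integral_Mellin_inverse_square)
       (auto simp: J_def has_bochner_integral_iff)
  hence H: "tanh_transform s y = of_real (y\<^sup>2) * (of_real pi / 2 * of_real y powr (s - 2) / S - J)"
    unfolding tanh_transform_def by (simp add: has_bochner_integral_iff algebra_simps diff_divide_distrib)
  have "y\<^sup>2 \<noteq> (node n)\<^sup>2" for n
    using y node_pos[of n] by (auto simp: power2_eq_iff)
  \<comment> \<open>Off the nodes \<open>cos_quot\<close> is the plain quotient, so cos y factors
    out of the series.\<close>
  hence "(\<lambda>n. of_real (node n) powr (s - 1) * of_real (cos_quot n y)) =
      (\<lambda>n. of_real (cos y) * (of_real (node n) powr (s - 1) / of_real (y\<^sup>2 - (node n)\<^sup>2)))"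
    by (auto simp: cos_quot_def)
  hence "(\<Sum>n. of_real (node n) powr (s - 1) * of_real (cos_quot n y)) =
      of_real (cos y) * (c / of_real pi * J - of_real y powr (s - 2) * of_real (tan y) / 2)"
    using sums_mult[OF node_series_sums[OF s y], of "of_real (cos y)"]
    by (simp add: sums_iff J_def c_def)
  hence g: "g1 s y = of_real pi * 2 powr (s - 1) * (of_real y)\<^sup>2 / c *
      (of_real (cos y) * (c / of_real pi * J - of_real y powr (s - 2) * of_real (tan y) / 2))"
    by (simp add: g1_def c_def)
  have p1: "complex_of_real y powr s = of_real y powr (s - 2) * (of_real y)\<^sup>2"
    using y powr_add[of "of_real y" "s - 2" 2] by simp
  have p2: "(2::complex) powr (s - 1) = 2 powr (s - 2) * 2"
    using powr_add[of "2::complex" "s - 2" 1] by simp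
  have "cos y * tan y = sin y" using cosy by (simp add: tan_def)
  hence t: "complex_of_real (sin y) = of_real (cos y) * of_real (tan y)" by (metis of_real_mult)
  have "g1 s y = 2 powr (s - 1) * of_real (cos y) * (of_real y)\<^sup>2 * J
      - of_real pi * 2 powr (s - 2) * (of_real y powr s * of_real (sin y) / c)"
    unfolding g p1 p2 t using c by (simp add: field_simps)
  moreover have "f1 s y = of_real pi * 2 powr (s - 2) * (of_real y powr s * of_real (cos y) / S)
      - of_real pi * 2 powr (s - 2) * (of_real y powr s * of_real (sin y) / c)"
    using y by (simp add: f1_def S_def c_def right_diff_distrib)
  moreover have "2 powr (s - 1) * of_real (cos y) * tanh_transform s y =
      of_real pi * 2 powr (s - 2) * (of_real y powr s * of_real (cos y) / S) - 2 powr (s - 1) * of_real (cos y) * (of_real y)\<^sup>2 * J"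
    unfolding H p1 p2 by (simp add: algebra_simps)
  ultimately show ?thesis by simp
qed

text \<open>Both sides are even in y: sgn y and sin y change sign together, and every other factor
  is even.\<close>

lemma f1_minus_g1:
  assumes s: "0 < Re s" "Re s < 1" and y: "y \<noteq> 0" "\<bar>y\<bar> \<notin> range node"
  shows "f1 s y - g1 s y = 2 powr (s - 1) * of_real (cos y) * tanh_transform s y"
proof -
  have "y\<^sup>2 \<noteq> (node n)\<^sup>2" for n
    using y node_pos[of n] by (auto simp: power2_eq_iff abs_if split: if_splits)
  hence "cos_quot n (- y) = cos_quot n y" for n by (simp add: cos_quot_def)
  hence "f1 s (- y) - g1 s (- y) = f1 s y - g1 s y"
    by (simp add: f1_def g1_def sgn_minus)
  moreover have "tanh_transform s (- y) = tanh_transform s y" by (simp add: tanh_transform_def)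
  ultimately show ?thesis
    using f1_minus_g1_pos[of s "\<bar>y\<bar>"] s y by (cases "y > 0") auto
qed

section \<open>Membership in the spaces Lp\<close>

lemma integrable_one_minus_tanh_Mellin:
  "Re s > 0 \<Longrightarrow> integrable pos_lborel (\<lambda>x. of_real x powr (s - 1) * complex_of_real (1 - tanh x))"
  using dirichlet_eta_Mellin by (simp add: has_bochner_integral_iff)

lemma measurable_tanh_transform_integrand:
  "(\<lambda>(y, x). of_real x powr (s - 1) * complex_of_real (1 - tanh x) * of_real (y\<^sup>2 / (x\<^sup>2 + y\<^sup>2)))
     \<in> borel_measurable (borel \<Otimes>\<^sub>M pos_lborel)"
proof -
  have [measurable]: "(\<lambda>x::real. tanh x) \<in> borel_measurable pos_lborel"
    by (intro borel_measurable_pos_lborel_continuous continuous_intros) auto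
  show ?thesis by measurable
qed

lemma measurable_tanh_transform: "tanh_transform s \<in> borel_measurable borel"
  unfolding tanh_transform_def [abs_def]
  using pos_lborel.borel_measurable_lebesgue_integral[OF measurable_tanh_transform_integrand] by simp

lemma tanh_transform_bounded:
  assumes "Re s > 0"
  shows "norm (tanh_transform s y) \<le> (\<integral>x. norm (of_real x powr (s - 1) * complex_of_real (1 - tanh x)) \<partial>pos_lborel)"
  unfolding tanh_transform_def
proof (rule Bochner_Integration.integral_norm_bound_integral[OF _ integrable_norm[OF integrable_one_minus_tanh_Mellin[OF assms]]])
  have 1: "norm (of_real x powr (s - 1) * complex_of_real (1 - tanh x) * of_real (y\<^sup>2 / (x\<^sup>2 + y\<^sup>2)))
      \<le> norm (of_real x powr (s - 1) * complex_of_real (1 - tanh x))" for x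
  proof -
    have "\<bar>y\<^sup>2 / (x\<^sup>2 + y\<^sup>2)\<bar> \<le> 1"
      using zero_le_power2[of x] zero_le_power2[of y] unfolding abs_divide divide_le_eq_1 by linarith
    thus ?thesis unfolding norm_mult[of _ "of_real (y\<^sup>2 / (x\<^sup>2 + y\<^sup>2))"] norm_of_real
      by (intro mult_left_le) auto
  qed
  show "norm (of_real x powr (s - 1) * complex_of_real (1 - tanh x) * of_real (y\<^sup>2 / (x\<^sup>2 + y\<^sup>2)))
      \<le> norm (of_real x powr (s - 1) * complex_of_real (1 - tanh x))" for x by (rule 1)
  have "(\<lambda>x. of_real x powr (s - 1) * complex_of_real (1 - tanh x) * of_real (y\<^sup>2 / (x\<^sup>2 + y\<^sup>2))) \<in> borel_measurable pos_lborel"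
    using measurable_compose[OF measurable_Pair1'[of y borel pos_lborel] measurable_tanh_transform_integrand[of s]] by simp
  thus "integrable pos_lborel (\<lambda>x. of_real x powr (s - 1) * complex_of_real (1 - tanh x) * of_real (y\<^sup>2 / (x\<^sup>2 + y\<^sup>2)))"
    using 1 by (intro Bochner_Integration.integrable_bound[OF integrable_one_minus_tanh_Mellin[OF assms]]) auto
qed

text \<open>The defect 1 - y^2 / (x^2 + y^2) = x^2 / (x^2 + y^2) is at most x^2 / y^2. The extra x^2
  moves the exponent from s - 1 to s + 1, that is, to the convergent Mellin integral at s +
  2.\<close>

lemma tanh_transform_asymptotics:
  assumes s: "Re s > 0" and y: "y \<noteq> 0"
  shows "norm (tanh_transform s y - 2 powr (1 - s) * Gamma s * dirichlet_eta s) * y\<^sup>2 \<le>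
     (\<integral>x. norm (of_real x powr (s + 1) * complex_of_real (1 - tanh x)) \<partial>pos_lborel)"
proof -
  let ?k = "\<lambda>x. of_real x powr (s - 1) * complex_of_real (1 - tanh x)"
  let ?k2 = "\<lambda>x. of_real x powr (s + 1) * complex_of_real (1 - tanh x)"
  let ?w = "\<lambda>x. of_real (1 / (x\<^sup>2 + y\<^sup>2)) :: complex"
  have k2: "integrable pos_lborel ?k2"
    using integrable_one_minus_tanh_Mellin[of "s + 2"] s by (simp add: add.commute)
  have pos: "x\<^sup>2 + y\<^sup>2 > 0" for x using y by (auto intro: add_nonneg_pos)
  have bound: "norm (?k2 x * ?w x) \<le> norm (?k2 x) / y\<^sup>2" for x
  proof -
    have "norm (?k2 x * ?w x) = norm (?k2 x) / (x\<^sup>2 + y\<^sup>2)"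
      using pos[of x] unfolding norm_mult norm_of_real by simp
    also have "\<dots> \<le> norm (?k2 x) / y\<^sup>2"
      using y by (intro divide_left_mono mult_pos_pos pos) auto
    finally show ?thesis .
  qed
  have int: "integrable pos_lborel (\<lambda>x. ?k2 x * ?w x)"
  proof (rule Bochner_Integration.integrable_bound)
    show "integrable pos_lborel (\<lambda>x. norm (?k2 x) / y\<^sup>2)" using k2 by simp
    have [measurable]: "?k2 \<in> borel_measurable pos_lborel" using k2 by simp
    show "(\<lambda>x. ?k2 x * ?w x) \<in> borel_measurable pos_lborel" by measurable
  qed (use bound in auto)
  have "has_bochner_integral pos_lborel (\<lambda>x. ?k x - ?k2 x * ?w x)
      (2 powr (1 - s) * Gamma s * dirichlet_eta s - (\<integral>x. ?k2 x * ?w x \<partial>pos_lborel))"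
    using int by (intro has_bochner_integral_diff dirichlet_eta_Mellin s has_bochner_integral_integrable)
  also have "?this \<longleftrightarrow> has_bochner_integral pos_lborel (\<lambda>x. ?k x * of_real (y\<^sup>2 / (x\<^sup>2 + y\<^sup>2)))
      (2 powr (1 - s) * Gamma s * dirichlet_eta s - (\<integral>x. ?k2 x * ?w x \<partial>pos_lborel))"
  proof (rule has_bochner_integral_cong)
    fix x assume "x \<in> space pos_lborel"
    hence "complex_of_real x powr (s + 1) = of_real x powr (s - 1) * of_real (x\<^sup>2)"
      using powr_add[of "of_real x" "s - 1" 2] by (simp add: add.commute)
    hence "?k x - ?k2 x * ?w x = ?k x * of_real (1 - x\<^sup>2 * (1 / (x\<^sup>2 + y\<^sup>2)))"
      by (simp only: of_real_diff of_real_mult of_real_1 right_diff_distrib mult_1_left mult_1_right mult_ac)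
    also have "1 - x\<^sup>2 * (1 / (x\<^sup>2 + y\<^sup>2)) = y\<^sup>2 / (x\<^sup>2 + y\<^sup>2)"
      using y by (simp add: diff_eq_eq add_nonneg_eq_0_iff flip: add_divide_distrib)
    finally show "?k x - ?k2 x * ?w x = ?k x * of_real (y\<^sup>2 / (x\<^sup>2 + y\<^sup>2))" .
  qed auto
  finally have "norm (tanh_transform s y - 2 powr (1 - s) * Gamma s * dirichlet_eta s) = norm (\<integral>x. ?k2 x * ?w x \<partial>pos_lborel)"
    by (simp only: tanh_transform_def has_bochner_integral_iff) simp
  also have "\<dots> \<le> (\<integral>x. norm (?k2 x) / y\<^sup>2 \<partial>pos_lborel)"
    by (rule Bochner_Integration.integral_norm_bound_integral[OF int]) (use k2 bound in auto)
  also have "\<dots> = (\<integral>x. norm (?k2 x) \<partial>pos_lborel) / y\<^sup>2" by simp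
  finally show ?thesis using y by (simp add: pos_le_divide_eq)
qed

section \<open>Criteria for membership and non-membership\<close>

lemma Lp_cong_AE:
  assumes ae: "AE y in lebesgue. F y = G y"
  shows "F \<in> Lp p \<longleftrightarrow> G \<in> Lp p"
proof -
  \<comment> \<open>Lebesgue measure is complete, so preimages that differ by a null set are
    measurable together. In this way the difference inherits measurability from its closed
    form.\<close>
  have measurable: "f \<in> borel_measurable lebesgue"
    if g: "g \<in> borel_measurable lebesgue" and ae: "AE y in lebesgue. f y = g y" for f g :: "real \<Rightarrow> complex"
  proof (rule measurableI)
    fix A :: "complex set" assume "A \<in> sets borel"
    hence "g -` A \<inter> space lebesgue \<in> sets lebesgue" using g by (rule measurable_sets[rotated])
    moreover have "AE y in lebesgue. y \<in> g -` A \<inter> space lebesgue \<longleftrightarrow> y \<in> f -` A \<inter> space lebesgue"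
      using ae by eventually_elim auto
    ultimately show "f -` A \<inter> space lebesgue \<in> sets lebesgue"
      using completion.in_sets_AE by blast
  qed auto
  have "AE y in lebesgue. G y = F y" using ae by eventually_elim auto
  hence "F \<in> borel_measurable lebesgue \<longleftrightarrow> G \<in> borel_measurable lebesgue"
    using measurable ae by blast
  moreover have "(\<integral>\<^sup>+ y. ennreal (norm (F y) powr p) \<partial>lebesgue) = (\<integral>\<^sup>+ y. ennreal (norm (G y) powr p) \<partial>lebesgue)"
    using ae by (intro nn_integral_cong_AE) (auto elim: eventually_mono)
  ultimately show ?thesis by (simp add: Lp_def)
qed

lemma Lp_borel_iff:
  assumes "G \<in> borel_measurable borel"
  shows "G \<in> Lp p \<longleftrightarrow> (\<integral>\<^sup>+ y. ennreal (norm (G y) powr p) \<partial>lborel) < \<infinity>"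
  using assms by (simp add: Lp_def nn_integral_completion measurable_completion)

text \<open>The constant bound handles [-1, 1]; outside, the p-th power is at most B^p |y|^(-2 p),
  which is integrable because 2 p > 1.\<close>

lemma Lp_of_inverse_square_decay:
  fixes G :: "real \<Rightarrow> complex"
  assumes G: "G \<in> borel_measurable borel" and A: "\<And>y. norm (G y) \<le> A"
    and B: "\<And>y. y \<noteq> 0 \<Longrightarrow> norm (G y) * y\<^sup>2 \<le> B" and p: "p > 1 / 2"
  shows "G \<in> Lp p"
proof -
  \<comment> \<open>The tail majorant for y \<ge> 1; its reflection \<open>t (- y)\<close> covers y
    \<le> -1.\<close>
  define t where "t = (\<lambda>y::real. ennreal (y powr (- 2 * p)) * indicator {1..} y)"
  have [measurable]: "t \<in> borel_measurable borel" unfolding t_def by measurable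
  have "((\<lambda>y. y powr (- 2 * p)) has_integral - (1 powr (- 2 * p + 1)) / (- 2 * p + 1)) {1..}"
    using p by (intro has_integral_powr_to_inf) auto
  hence "integral\<^sup>N lborel t = ennreal (- (1 powr (- 2 * p + 1)) / (- 2 * p + 1))"
    unfolding t_def by (intro nn_integral_has_integral_lebesgue') auto
  hence t: "integral\<^sup>N lborel t < \<infinity>" by simp
  have t': "(\<integral>\<^sup>+ y. t (- y) \<partial>lborel) = integral\<^sup>N lborel t"
    using nn_integral_real_affine[of t "-1" 0] by simp
  have bound: "ennreal (norm (G y) powr p) \<le> ennreal (A powr p) * indicator {-1..1} y
      + ennreal (B powr p) * t y + ennreal (B powr p) * t (- y)" for y
  proof (cases "\<bar>y\<bar> \<le> 1")
    case True
    hence "ennreal (norm (G y) powr p) \<le> ennreal (A powr p) * indicator {-1..1} y"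
      using A[of y] p by (auto simp: indicator_def intro!: ennreal_leI powr_mono2)
    thus ?thesis by (simp add: add_increasing2 add.assoc)
  next
    case False
    hence "norm (G y) \<le> B / y\<^sup>2" using B[of y] by (simp add: pos_le_divide_eq)
    hence "norm (G y) powr p \<le> (B / y\<^sup>2) powr p" using p by (intro powr_mono2) auto
    also have "\<dots> = B powr p * \<bar>y\<bar> powr (- 2 * p)"
    proof -
      have "0 \<le> B" using B[of 1] by (intro order_trans[OF _ B[of 1]]) auto
      moreover have "y\<^sup>2 powr p = \<bar>y\<bar> powr (2 * p)"
        using False powr_powr[of "\<bar>y\<bar>" 2 p] by simp
      moreover from \<open>0 \<le> B\<close> have "(B / y\<^sup>2) powr p = B powr p / y\<^sup>2 powr p"
        by (simp add: powr_divide)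
      ultimately show ?thesis by (simp add: powr_minus divide_inverse)
    qed
    finally have le: "ennreal (norm (G y) powr p) \<le> ennreal (B powr p) * ennreal (\<bar>y\<bar> powr (- 2 * p))"
      by (simp add: ennreal_leI flip: ennreal_mult)
    show ?thesis
    proof (cases "y > 0")
      case True
      with le False show ?thesis
        by (simp add: t_def indicator_def)
    next
      case f: False
      with le False show ?thesis by (simp add: t_def indicator_def)
    qed
  qed
  have "(\<integral>\<^sup>+ y. ennreal (norm (G y) powr p) \<partial>lborel) \<le> (\<integral>\<^sup>+ y. ennreal (A powr p) * indicator {-1..1} y
      + ennreal (B powr p) * t y + ennreal (B powr p) * t (- y) \<partial>lborel)"
    by (intro nn_integral_mono bound)
  also have "\<dots> = ennreal (A powr p) * 2 + ennreal (B powr p) * integral\<^sup>N lborel t + ennreal (B powr p) * integral\<^sup>N lborel t"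
    by (simp add: nn_integral_add nn_integral_cmult t' nn_integral_cmult_indicator)
  also have "\<dots> < \<infinity>" using t by (simp add: ennreal_mult_less_top ennreal_add_less_top)
  finally show ?thesis using G by (simp add: Lp_borel_iff)
qed

text \<open>The intervals [k pi, k pi + 1] are disjoint as 1 < pi, and |cos| is at least 1/2 on them
  as 1 < pi / 3. Each one beyond Y contributes at least (c / 2)^p to the integral.\<close>

lemma not_Lp_of_ge_cos:
  fixes G :: "real \<Rightarrow> complex"
  assumes G: "G \<in> borel_measurable borel" and c: "c > 0"
    and ge: "\<And>y. y \<ge> Y \<Longrightarrow> norm (G y) \<ge> c * \<bar>cos y\<bar>" and p: "p > 0"
  shows "G \<notin> Lp p"
proof
  assume "G \<in> Lp p"
  hence fin: "(\<integral>\<^sup>+ y. ennreal (norm (G y) powr p) \<partial>lborel) < \<infinity>" using G by (simp add: Lp_borel_iff)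
  \<comment> \<open>This offset keeps every interval within y \<ge> Y.\<close>
  define m where "m = nat \<lceil>\<bar>Y\<bar>\<rceil>"
  define I where "I = (\<lambda>k. {real (m + k) * pi .. real (m + k) * pi + 1})"
  have disj: "disjoint_family I"
  proof -
    have "x \<notin> I j" if "i < j" "x \<in> I i" for i j x
    proof -
      have "real (m + i) * pi + 1 < real (m + i) * pi + pi" using pi_gt3 by simp
      also have "\<dots> = real (m + i + 1) * pi" by (simp add: distrib_right)
      also have "\<dots> \<le> real (m + j) * pi" using that by (intro mult_right_mono) auto
      finally show ?thesis using that by (auto simp: I_def)
    qed
    thus ?thesis unfolding disjoint_family_on_def by (metis disjoint_iff nat_neq_iff)
  qed
  have big: "ennreal ((c / 2) powr p) * indicator (\<Union>k\<in>{..<N}. I k) y \<le> ennreal (norm (G y) powr p)" for N y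
  proof (cases "y \<in> (\<Union>k\<in>{..<N}. I k)")
    case True
    then obtain k where k: "y \<in> I k" by blast
    define r where "r = y - real (m + k) * pi"
    have r: "0 \<le> r" "r \<le> 1" using k by (auto simp: r_def I_def)
    have "cos 1 > cos (pi / 3)" using pi_gt3 by (intro cos_monotone_0_pi) auto
    moreover have "cos r \<ge> cos 1" using r pi_gt3 by (intro cos_monotone_0_pi_le) auto
    ultimately have "cos r \<ge> 1 / 2" by (simp add: cos_60)
    moreover have "\<bar>cos y\<bar> = \<bar>cos r\<bar>"
    proof -
      have "y = r + real (m + k) * pi" by (simp add: r_def)
      hence "cos y = cos r * (-1) ^ (m + k)" by (simp add: cos_add cos_npi sin_npi del: of_nat_add)
      thus ?thesis by (simp add: abs_mult power_abs)
    qed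
    ultimately have "c * \<bar>cos y\<bar> \<ge> c * (1 / 2)" using c by (intro mult_left_mono) auto
    moreover have "y \<ge> Y"
    proof -
      have "Y \<le> real m" unfolding m_def by linarith
      also have "\<dots> \<le> real (m + k) * 1" by simp
      also have "\<dots> \<le> real (m + k) * pi" using pi_gt3 by (intro mult_left_mono) auto
      finally show ?thesis using k by (simp add: I_def)
    qed
    ultimately have "c / 2 \<le> norm (G y)" using ge[of y] by simp
    thus ?thesis using True c p by (simp add: ennreal_leI powr_mono2)
  qed simp
  have "ennreal ((c / 2) powr p) * of_nat N \<le> (\<integral>\<^sup>+ y. ennreal (norm (G y) powr p) \<partial>lborel)" for N
  proof -
    have "of_nat N = (\<Sum>k<N. emeasure lborel (I k))" by (simp add: I_def)
    also have "\<dots> = emeasure lborel (\<Union>k\<in>{..<N}. I k)"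
      using disj by (intro sum_emeasure) (auto simp: I_def disjoint_family_on_def)
    finally have "ennreal ((c / 2) powr p) * of_nat N = (\<integral>\<^sup>+ y. ennreal ((c / 2) powr p) * indicator (\<Union>k\<in>{..<N}. I k) y \<partial>lborel)"
      by (simp add: nn_integral_cmult_indicator I_def)
    also have "\<dots> \<le> (\<integral>\<^sup>+ y. ennreal (norm (G y) powr p) \<partial>lborel)"
      by (intro nn_integral_mono big)
    finally show ?thesis .
  qed
  moreover obtain R where R: "(\<integral>\<^sup>+ y. ennreal (norm (G y) powr p) \<partial>lborel) = ennreal R" "R \<ge> 0"
    using fin by (cases "\<integral>\<^sup>+ y. ennreal (norm (G y) powr p) \<partial>lborel") auto
  ultimately have "ennreal ((c / 2) powr p * real N) \<le> ennreal R" for N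
    by (simp add: ennreal_mult ennreal_of_nat_eq_real_of_nat)
  hence "(c / 2) powr p * real N \<le> R" for N using R by (simp add: ennreal_le_iff)
  moreover have "(c / 2) powr p > 0" using c by simp
  then obtain N where "R < real N * (c / 2) powr p" using reals_Archimedean3 by blast
  ultimately show False by (metis mult.commute not_le)
qed

text \<open>The norm of 2^(1-s) is 2^(1 - Re s) > 1. Hence a nonzero value of zeta gives a nonzero
  value of eta.\<close>

lemma one_minus_two_powr_nonzero:
  assumes "Re s < 1"
  shows "1 - 2 powr (1 - s) \<noteq> (0 :: complex)"
proof
  assume "1 - 2 powr (1 - s) = (0 :: complex)"
  hence "norm (2 powr (1 - s) :: complex) = 1" by simp
  moreover have "norm (2 powr (1 - s) :: complex) = 2 powr (1 - Re s)"
    using norm_powr_real_powr[of 2 "1 - s"] by simp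
  moreover have "2 powr (1 - Re s) > (1::real)" using assms by simp
  ultimately show False by simp
qed

theorem corollary2p5:
  fixes s :: complex
  assumes "0 < Re s" and "Re s < 1"
  shows "(riemann_zeta s = 0 \<longrightarrow> (\<forall>p::real. p > 1 / 2 \<longrightarrow> (\<lambda>y. f1 s y - g1 s y) \<in> Lp p)) \<and>
         ((\<exists>p::real. p > 1 / 2 \<and> (\<lambda>y. f1 s y - g1 s y) \<in> Lp p) \<longrightarrow> riemann_zeta s = 0)"
proof -
  define G where "G = (\<lambda>y. 2 powr (s - 1) * of_real (cos y) * tanh_transform s y)"
  define L where "L = 2 powr (1 - s) * Gamma s * dirichlet_eta s"
  define K where "K = norm (2 powr (s - 1) :: complex)"
  define A where "A = (\<integral>x. norm (of_real x powr (s - 1) * complex_of_real (1 - tanh x)) \<partial>pos_lborel)"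
  define B where "B = (\<integral>x. norm (of_real x powr (s + 1) * complex_of_real (1 - tanh x)) \<partial>pos_lborel)"
  have A: "norm (tanh_transform s y) \<le> A" for y
    unfolding A_def by (rule tanh_transform_bounded[OF assms(1)])
  have B: "norm (tanh_transform s y - L) * y\<^sup>2 \<le> B" if "y \<noteq> 0" for y
    unfolding B_def L_def using assms that by (intro tanh_transform_asymptotics)
  have K: "K > 0" by (simp add: K_def)
  have G: "G \<in> borel_measurable borel"
    unfolding G_def using measurable_tanh_transform[of s] by measurable
  have norm_G: "norm (G y) = K * \<bar>cos y\<bar> * norm (tanh_transform s y)" for y
    by (simp add: G_def K_def norm_mult)
  have norm_G_le: "norm (G y) \<le> K * norm (tanh_transform s y)" for y
    unfolding norm_G using K by (intro mult_right_mono) (auto intro: mult_left_le)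
  \<comment> \<open>The points not covered by the closed form: 0 and the zeros of cos.\<close>
  have "countable ({0} \<union> range node \<union> uminus ` range node)" by simp
  hence "AE y in lebesgue. y \<notin> {0} \<union> range node \<union> uminus ` range node"
    by (intro AE_completion AE_not_in countable_imp_null_set_lborel)
  hence "AE y in lebesgue. f1 s y - g1 s y = G y"
  proof eventually_elim
    case (elim y)
    have "\<bar>y\<bar> \<notin> range node"
    proof
      assume "\<bar>y\<bar> \<in> range node"
      then obtain n where "\<bar>y\<bar> = node n" by blast
      hence "y = node n \<or> y = - node n" by linarith
      thus False using elim by blast
    qed
    thus ?case unfolding G_def using assms elim by (intro f1_minus_g1) auto
  qed
  hence Lp_iff: "(\<lambda>y. f1 s y - g1 s y) \<in> Lp p \<longleftrightarrow> G \<in> Lp p" for p by (rule Lp_cong_AE)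
  have dirichlet_eta: "dirichlet_eta s = (1 - 2 powr (1 - s)) * riemann_zeta s"
    using assms by (intro dirichlet_eta_eq_riemann_zeta) auto
  show ?thesis
  proof (intro conjI impI allI)
    fix p :: real assume zero: "riemann_zeta s = 0" and p: "p > 1 / 2"
    \<comment> \<open>With limit 0 the asymptotic estimate is itself the inverse-square
      decay.\<close>
    have L0: "L = 0" using zero dirichlet_eta by (simp add: L_def)
    show "(\<lambda>y. f1 s y - g1 s y) \<in> Lp p" unfolding Lp_iff
    proof (rule Lp_of_inverse_square_decay[OF G _ _ p])
      show "norm (G y) \<le> K * A" for y
        using A[of y] K by (intro order_trans[OF norm_G_le] mult_left_mono) auto
      fix y :: real assume "y \<noteq> 0"
      have "norm (G y) * y\<^sup>2 \<le> K * norm (tanh_transform s y) * y\<^sup>2"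
        by (intro mult_right_mono norm_G_le) auto
      also have "\<dots> = K * (norm (tanh_transform s y) * y\<^sup>2)" by simp
      also have "\<dots> \<le> K * B" using B[OF \<open>y \<noteq> 0\<close>] L0 K by (intro mult_left_mono) auto
      finally show "norm (G y) * y\<^sup>2 \<le> K * B" .
    qed
  next
    assume "\<exists>p>1 / 2. (\<lambda>y. f1 s y - g1 s y) \<in> Lp p"
    then obtain p where p: "p > 1 / 2" and Lp: "G \<in> Lp p" unfolding Lp_iff by blast
    show "riemann_zeta s = 0"
    proof (rule ccontr)
      assume nz: "riemann_zeta s \<noteq> 0"
      \<comment> \<open>\<open>Gamma\<close> is 0 by convention at its poles and nonzero everywhere
        else, so s must be kept off the poles.\<close>
      have "s \<notin> \<int>\<^sub>\<le>\<^sub>0" using assms by (auto elim!: nonpos_Ints_cases)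
      hence L: "L \<noteq> 0"
        using nz dirichlet_eta one_minus_two_powr_nonzero[OF assms(2)] by (simp add: L_def Gamma_eq_zero_iff)
      \<comment> \<open>For y \<ge> Y the error is at most B / y^2 \<le> B / y \<le>
        \<open>norm L / 2\<close>; the summand 1 ensures y \<ge> 1, and so y \<le> y^2.\<close>
      define Y where "Y = 1 + 2 * B / norm L"
      have "B \<ge> 0" unfolding B_def by simp
      hence Y: "Y \<ge> 1" using L by (simp add: Y_def)
      have "G \<notin> Lp p"
      proof (rule not_Lp_of_ge_cos[OF G, where c = "K * norm L / 2" and Y = Y])
        fix y assume y: "y \<ge> Y"
        have "norm (tanh_transform s y - L) * y \<le> norm (tanh_transform s y - L) * y\<^sup>2"
          using y Y by (intro mult_left_mono) (auto simp: power2_eq_square)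
        also have "\<dots> \<le> B" using y Y by (intro B) auto
        also have "\<dots> \<le> norm L / 2 * Y"
          using L by (simp add: Y_def field_simps)
        also have "\<dots> \<le> norm L / 2 * y" using y by (intro mult_left_mono) auto
        finally have "norm (tanh_transform s y - L) \<le> norm L / 2" using y Y by simp
        hence "norm L / 2 \<le> norm (tanh_transform s y)"
          using norm_triangle_ineq2[of L "L - tanh_transform s y"] by (simp add: norm_minus_commute)
        hence "K * \<bar>cos y\<bar> * (norm L / 2) \<le> norm (G y)"
          unfolding norm_G using K by (intro mult_left_mono) auto
        thus "K * norm L / 2 * \<bar>cos y\<bar> \<le> norm (G y)" by (simp add: mult_ac)
      qed (use K L p in auto)
      thus False using Lp by contradiction
    qed
  qed
qed

end
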